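(* Let $\mathcal{L}$ be a finite relational language and $T_\forall$ a universal $\mathcal{L}$-theory such that the class of finite models of $T_\forall$ is a Fraïssé class with the Strong Amalgamation Property, and let $T^*$ be the theory of the Fraïssé limit of the class of finite models of $T^*_\forall$ (as defined in the context). Let $M\models T^*$ with monster model $\mathfrak{C}$, let $B$ be a branch (maximal chain) of $M$, let $q_T(x)$ be the unique complete type over $M$ determined by $\{x>b : b\in B\}$, let $c\in\mathfrak{C}$ realize $q_T$, and let $\pi_T(x)=q_T(x)\cup\{x<c\}$. Then the partial type $\{x<c\}$ ($x$ a single variable) is dp-minimal, distal and co-distal; in particular, it is NIP. Consequently (as $\pi_T$ contains $x<c$), $\pi_T$ is dp-minimal, distal and co-distal.
   Context: A Fraïssé class is a class of finitely generated structures with the hereditary property (HP), joint embedding property (JEP) and amalgamation property (AP). It has the Strong Amalgamation Property (SAP) if in AP, for embeddings $f_1:A\to B$, $f_2:A\to C$ the amalgamating embeddings $g_1:B\to D$, $g_2:C\to D$ ($g_1f_1=g_2f_2$) can be chosen with $\mathrm{Im}(g_1)\cap\mathrm{Im}(g_2)=\mathrm{Im}(g_2 f_2)$, and in JEP the images of the two structures can be chosen disjoint. Trees: $\mathcal{L}_{Tr}=\{\leq,\wedge\}$, and $Tr$ is the theory of meet-trees: $\leq$ is a partial order such that $\{y : y\leq x\}$ is linearly ordered for every $x$, and $x\wedge y$ is the greatest element of $\{z : z\leq x,y\}$. The theory $T^*_\forall$: for each $n$-place relation symbol $R\in\mathcal{L}$ let $R^*$ be an $(n+1)$-place relation symbol,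 and let $\mathcal{L}^*=\mathcal{L}_{Tr}\cup\{R^* : R\in\mathcal{L}\}$. Let $=^*(x,y,y')$ stand for $x<y\wedge y'$. For a quantifier-free $\mathcal{L}$-formula $\psi(y)$ ($y$ a tuple), $\psi^*(x,y)$ is obtained from $\psi$ by replacing each atomic formula $R(\dots)$ (including equality) by $R^*(x,\dots)$. $T^*_\forall$ consists of the axioms of $Tr$; for each $n$-place $R\in\mathcal{L}$ the axioms (WD) $\forall x,y_0,\dots,y_{n-1},y'_0,\dots,y'_{n-1}\,\big(R^*(x,y_0,\dots,y_{n-1})\ \&\ x<y_i\wedge y'_i \text{ for all } i<n\big)\to R^*(x,y'_0,\dots,y'_{n-1})$, and (OC) $\forall x,y_0,\dots,y_{n-1}\, R^*(x,y_0,\dots,y_{n-1})\to x<y_i$ for all $i<n$; and for each axiom $\forall y\,\psi(y)$ of $T_\forall$ the axiom $\forall x,y\,(x<y\to\psi^*(x,y))$, where $x<y$ means that $x$ is smaller than every variable in $y$. The finite models of $T^*_\forall$ form a uniformly locally finite Fraïssé class, and $T^*$ is the theory of its Fraïssé limit; it has quantifier elimination, is $\omega$-categorical and is the model completion of $T^*_\forall$. The partial type $\{x>b : b\in B\}$ determines a unique complete type over $M$. dp-minimal: a partial type $\Sigma(x)$ over $A$ is dp-minimal if its dp-rank is $<2$, i.e. whenever $I_0,I_1$ are $A$-mutually indiscernible infinite sequences and $b\models\Sigma$, at least one of $I_0,I_1$ is indiscernible over $bA$ (this does not depend on the set $A$ containing the parameters of $\Sigma$). Distal: a partial type $\Sigma(x)$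 is distal if for every tuple $d$ and every indiscernible sequence $I_1+a+I_2$ of realizations of $\Sigma$, where $I_1,I_2$ are infinite without endpoints, $I_1+I_2$ is $d$-indiscernible iff $I_1+a+I_2$ is $d$-indiscernible. Co-distal: a partial type $\Sigma(x)$ over $A$ is co-distal over $A$ if for every $d\models\Sigma$ and every $A$-indiscernible sequence $I_1+a+I_2$ (with $I_1,I_2$ infinite without endpoints), if $I_1+I_2$ is indiscernible over $Ad$ then $I_1+a+I_2$ is indiscernible over $Ad$. When $A$ is not specified, it is the domain of $\Sigma$ (so $\{c\}$ for $\{x<c\}$, and $Mc$ for $\pi_T$). NIP: a partial type $\pi(x)$ has IP if there are a formula $\varphi(x,y)$ without parameters and realizations $(a_i)_{i<\omega}$ of $\pi$ such that for every $s\subseteq\omega$ the set $\{\varphi(a_i,y): i\in s\}\cup\{\neg\varphi(a_i,y): i\notin s\}$ is consistent; otherwise it is NIP. *)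

theory Defs
  imports "HOL-Library.Countable_Set"
begin

unbundle cardinal_syntax

section \<open>First-order logic\<close>

text \<open>
  The symbols of a language are the elements of the sets \<open>fsyms\<close> and \<open>rsyms\<close>, not of the whole
  symbol types, so that a language may have no symbols at all.
\<close>

record ('f, 'r) lang =
  fsyms :: "'f set"
  farity :: "'f \<Rightarrow> nat"
  rsyms :: "'r set"
  rarity :: "'r \<Rightarrow> nat"

datatype 'f tm = Var nat | Fn 'f "'f tm list"

datatype ('f, 'r) fm =
    Bot
  | Eq "'f tm" "'f tm"
  | Rel 'r "'f tm list"
  | Imp "('f, 'r) fm" "('f, 'r) fm"
  | All nat "('f, 'r) fm"

definition Neg :: "('f, 'r) fm \<Rightarrow> ('f, 'r) fm" where
  "Neg \<phi> = Imp \<phi> Bot"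

definition Conj :: "('f, 'r) fm \<Rightarrow> ('f, 'r) fm \<Rightarrow> ('f, 'r) fm" where
  "Conj \<phi> \<psi> = Neg (Imp \<phi> (Neg \<psi>))"

definition Disj :: "('f, 'r) fm \<Rightarrow> ('f, 'r) fm \<Rightarrow> ('f, 'r) fm" where
  "Disj \<phi> \<psi> = Imp (Neg \<phi>) \<psi>"

definition Conjs :: "('f, 'r) fm list \<Rightarrow> ('f, 'r) fm" where
  "Conjs \<phi>s = foldr Conj \<phi>s (Neg Bot)"

definition Alls :: "nat \<Rightarrow> ('f, 'r) fm \<Rightarrow> ('f, 'r) fm" where
  "Alls n \<phi> = foldr All [0..<n] \<phi>"

fun tm_vars :: "'f tm \<Rightarrow> nat set" where
  "tm_vars (Var i) = {i}"
| "tm_vars (Fn f ts) = (\<Union>t\<in>set ts. tm_vars t)"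

fun free_vars :: "('f, 'r) fm \<Rightarrow> nat set" where
  "free_vars Bot = {}"
| "free_vars (Eq s t) = tm_vars s \<union> tm_vars t"
| "free_vars (Rel R ts) = (\<Union>t\<in>set ts. tm_vars t)"
| "free_vars (Imp \<phi> \<psi>) = free_vars \<phi> \<union> free_vars \<psi>"
| "free_vars (All i \<phi>) = free_vars \<phi> - {i}"

fun is_tm :: "('f, 'r) lang \<Rightarrow> 'f tm \<Rightarrow> bool" where
  "is_tm L (Var i) \<longleftrightarrow> True"
| "is_tm L (Fn f ts) \<longleftrightarrow> f \<in> fsyms L \<and> length ts = farity L f \<and> (\<forall>t\<in>set ts. is_tm L t)"

fun is_fm :: "('f, 'r) lang \<Rightarrow> ('f, 'r) fm \<Rightarrow> bool" where
  "is_fm L Bot \<longleftrightarrow> True"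
| "is_fm L (Eq s t) \<longleftrightarrow> is_tm L s \<and> is_tm L t"
| "is_fm L (Rel R ts) \<longleftrightarrow> R \<in> rsyms L \<and> length ts = rarity L R \<and> (\<forall>t\<in>set ts. is_tm L t)"
| "is_fm L (Imp \<phi> \<psi>) \<longleftrightarrow> is_fm L \<phi> \<and> is_fm L \<psi>"
| "is_fm L (All i \<phi>) \<longleftrightarrow> is_fm L \<phi>"

fun quantifier_free :: "('f, 'r) fm \<Rightarrow> bool" where
  "quantifier_free (Imp \<phi> \<psi>) \<longleftrightarrow> quantifier_free \<phi> \<and> quantifier_free \<psi>"
| "quantifier_free (All i \<phi>) \<longleftrightarrow> False"
| "quantifier_free _ \<longleftrightarrow> True"

definition universal_sentence :: "('f, 'r) lang \<Rightarrow> ('f, 'r) fm \<Rightarrow> bool" where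
  "universal_sentence L \<sigma> \<longleftrightarrow>
    (\<exists>n \<psi>. \<sigma> = Alls n \<psi> \<and> quantifier_free \<psi> \<and> is_fm L \<psi> \<and> free_vars \<psi> \<subseteq> {..<n})"

definition relational :: "('f, 'r) lang \<Rightarrow> bool" where
  "relational L \<longleftrightarrow> fsyms L = {}"

record ('f, 'r, 'a) struct =
  univ :: "'a set"
  fint :: "'f \<Rightarrow> 'a list \<Rightarrow> 'a"
  rint :: "'r \<Rightarrow> 'a list \<Rightarrow> bool"

definition is_struct :: "('f, 'r) lang \<Rightarrow> ('f, 'r, 'a) struct \<Rightarrow> bool" where
  "is_struct L \<A> \<longleftrightarrow> univ \<A> \<noteq> {} \<and>
    (\<forall>f\<in>fsyms L. \<forall>xs\<in>lists (univ \<A>). length xs = farity L f \<longrightarrow> fint \<A> f xs \<in> univ \<A>)"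

fun eval_tm :: "('f, 'r, 'a) struct \<Rightarrow> (nat \<Rightarrow> 'a) \<Rightarrow> 'f tm \<Rightarrow> 'a" where
  "eval_tm \<A> e (Var i) = e i"
| "eval_tm \<A> e (Fn f ts) = fint \<A> f (map (eval_tm \<A> e) ts)"

fun sat :: "('f, 'r, 'a) struct \<Rightarrow> (nat \<Rightarrow> 'a) \<Rightarrow> ('f, 'r) fm \<Rightarrow> bool" where
  "sat \<A> e Bot \<longleftrightarrow> False"
| "sat \<A> e (Eq s t) \<longleftrightarrow> eval_tm \<A> e s = eval_tm \<A> e t"
| "sat \<A> e (Rel R ts) \<longleftrightarrow> rint \<A> R (map (eval_tm \<A> e) ts)"
| "sat \<A> e (Imp \<phi> \<psi>) \<longleftrightarrow> (sat \<A> e \<phi> \<longrightarrow> sat \<A> e \<psi>)"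
| "sat \<A> e (All i \<phi>) \<longleftrightarrow> (\<forall>x\<in>univ \<A>. sat \<A> (e(i := x)) \<phi>)"

definition models :: "('f, 'r, 'a) struct \<Rightarrow> ('f, 'r) fm set \<Rightarrow> bool" where
  "models \<A> T \<longleftrightarrow> (\<forall>\<phi>\<in>T. \<forall>e. range e \<subseteq> univ \<A> \<longrightarrow> sat \<A> e \<phi>)"

definition theory_of :: "('f, 'r) lang \<Rightarrow> ('f, 'r, 'a) struct \<Rightarrow> ('f, 'r) fm set" where
  "theory_of L \<A> = {\<phi>. is_fm L \<phi> \<and> free_vars \<phi> = {} \<and> models \<A> {\<phi>}}"

definition elementary_substruct ::
    "('f, 'r) lang \<Rightarrow> ('f, 'r, 'a) struct \<Rightarrow> ('f, 'r, 'a) struct \<Rightarrow> bool" where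
  "elementary_substruct L M C \<longleftrightarrow> is_struct L M \<and> is_struct L C \<and> univ M \<subseteq> univ C \<and>
    (\<forall>\<phi> e. is_fm L \<phi> \<and> range e \<subseteq> univ M \<longrightarrow> sat M e \<phi> = sat C e \<phi>)"

definition embedding ::
    "('f, 'r) lang \<Rightarrow> ('f, 'r, 'a) struct \<Rightarrow> ('f, 'r, 'b) struct \<Rightarrow> ('a \<Rightarrow> 'b) \<Rightarrow> bool" where
  "embedding L \<A> \<B> h \<longleftrightarrow> h ` univ \<A> \<subseteq> univ \<B> \<and> inj_on h (univ \<A>) \<and>
    (\<forall>f\<in>fsyms L. \<forall>xs\<in>lists (univ \<A>). length xs = farity L f \<longrightarrow>
       h (fint \<A> f xs) = fint \<B> f (map h xs)) \<and>
    (\<forall>R\<in>rsyms L. \<forall>xs\<in>lists (univ \<A>). length xs = rarity L R \<longrightarrow>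
       rint \<A> R xs = rint \<B> R (map h xs))"

definition isomorphism ::
    "('f, 'r) lang \<Rightarrow> ('f, 'r, 'a) struct \<Rightarrow> ('f, 'r, 'b) struct \<Rightarrow> ('a \<Rightarrow> 'b) \<Rightarrow> bool" where
  "isomorphism L \<A> \<B> h \<longleftrightarrow> embedding L \<A> \<B> h \<and> h ` univ \<A> = univ \<B>"

definition restrict_to :: "('f, 'r, 'a) struct \<Rightarrow> 'a set \<Rightarrow> ('f, 'r, 'a) struct" where
  "restrict_to \<A> S = \<A>\<lparr>univ := S\<rparr>"

definition finitely_generated :: "('f, 'r) lang \<Rightarrow> ('f, 'r, 'a) struct \<Rightarrow> bool" where
  "finitely_generated L \<A> \<longleftrightarrow> (\<exists>X. finite X \<and> X \<subseteq> univ \<A> \<and>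
    (\<forall>S. X \<subseteq> S \<and> S \<subseteq> univ \<A> \<and> is_struct L (restrict_to \<A> S) \<longrightarrow> S = univ \<A>))"


section \<open>Fraisse classes\<close>

text \<open>
  Only countable structures matter here, so an isomorphism-closed class is represented by its
  members whose universe is a set of natural numbers.
\<close>

type_synonym ('f, 'r) struct_class = "('f, 'r, nat) struct set"

definition HP :: "('f, 'r) lang \<Rightarrow> ('f, 'r) struct_class \<Rightarrow> bool" where
  "HP L K \<longleftrightarrow> (\<forall>B\<in>K. \<forall>A h.
    is_struct L A \<and> finitely_generated L A \<and> embedding L A B h \<longrightarrow> A \<in> K)"

definition JEP :: "('f, 'r) lang \<Rightarrow> ('f, 'r) struct_class \<Rightarrow> bool" where
  "JEP L K \<longleftrightarrow> (\<forall>B\<in>K. \<forall>C\<in>K. \<exists>D\<in>K. \<exists>g\<^sub>1 g\<^sub>2.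
    embedding L B D g\<^sub>1 \<and> embedding L C D g\<^sub>2)"

definition AP :: "('f, 'r) lang \<Rightarrow> ('f, 'r) struct_class \<Rightarrow> bool" where
  "AP L K \<longleftrightarrow> (\<forall>A\<in>K. \<forall>B\<in>K. \<forall>C\<in>K. \<forall>f\<^sub>1 f\<^sub>2.
    embedding L A B f\<^sub>1 \<and> embedding L A C f\<^sub>2 \<longrightarrow>
    (\<exists>D\<in>K. \<exists>g\<^sub>1 g\<^sub>2. embedding L B D g\<^sub>1 \<and> embedding L C D g\<^sub>2 \<and>
      (\<forall>x\<in>univ A. g\<^sub>1 (f\<^sub>1 x) = g\<^sub>2 (f\<^sub>2 x))))"

definition fraisse_class :: "('f, 'r) lang \<Rightarrow> ('f, 'r) struct_class \<Rightarrow> bool" where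
  "fraisse_class L K \<longleftrightarrow>
    (\<forall>A\<in>K. is_struct L A \<and> finitely_generated L A) \<and> HP L K \<and> JEP L K \<and> AP L K"

definition SAP :: "('f, 'r) lang \<Rightarrow> ('f, 'r) struct_class \<Rightarrow> bool" where
  "SAP L K \<longleftrightarrow>
    (\<forall>A\<in>K. \<forall>B\<in>K. \<forall>C\<in>K. \<forall>f\<^sub>1 f\<^sub>2.
      embedding L A B f\<^sub>1 \<and> embedding L A C f\<^sub>2 \<longrightarrow>
      (\<exists>D\<in>K. \<exists>g\<^sub>1 g\<^sub>2. embedding L B D g\<^sub>1 \<and> embedding L C D g\<^sub>2 \<and>
        (\<forall>x\<in>univ A. g\<^sub>1 (f\<^sub>1 x) = g\<^sub>2 (f\<^sub>2 x)) \<and>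
        g\<^sub>1 ` univ B \<inter> g\<^sub>2 ` univ C = (g\<^sub>2 \<circ> f\<^sub>2) ` univ A)) \<and>
    (\<forall>B\<in>K. \<forall>C\<in>K. \<exists>D\<in>K. \<exists>g\<^sub>1 g\<^sub>2.
      embedding L B D g\<^sub>1 \<and> embedding L C D g\<^sub>2 \<and> g\<^sub>1 ` univ B \<inter> g\<^sub>2 ` univ C = {})"

definition age :: "('f, 'r) lang \<Rightarrow> ('f, 'r, 'a) struct \<Rightarrow> ('f, 'r) struct_class" where
  "age L N = {A. is_struct L A \<and> finitely_generated L A \<and> (\<exists>h. embedding L A N h)}"

definition ultrahomogeneous :: "('f, 'r) lang \<Rightarrow> ('f, 'r, 'a) struct \<Rightarrow> bool" where
  "ultrahomogeneous L N \<longleftrightarrow> (\<forall>S S' h.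
    S \<subseteq> univ N \<and> is_struct L (restrict_to N S) \<and> finitely_generated L (restrict_to N S) \<and>
    S' \<subseteq> univ N \<and> is_struct L (restrict_to N S') \<and> finitely_generated L (restrict_to N S') \<and>
    isomorphism L (restrict_to N S) (restrict_to N S') h \<longrightarrow>
    (\<exists>g. isomorphism L N N g \<and> (\<forall>x\<in>S. g x = h x)))"

definition fraisse_limit ::
    "('f, 'r) lang \<Rightarrow> ('f, 'r) struct_class \<Rightarrow> ('f, 'r, 'a) struct \<Rightarrow> bool" where
  "fraisse_limit L K N \<longleftrightarrow> is_struct L N \<and> countable (univ N) \<and>
    age L N = K \<and> ultrahomogeneous L N"

definition finite_models :: "('f, 'r) lang \<Rightarrow> ('f, 'r) fm set \<Rightarrow> ('f, 'r) struct_class" where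
  "finite_models L T = {A. is_struct L A \<and> finite (univ A) \<and> models A T}"


section \<open>Treelike expansions\<close>

datatype tree_fun = Meet

datatype 'r star_rel = Leq | Star 'r

definition star_lang :: "('f, 'r) lang \<Rightarrow> (tree_fun, 'r star_rel) lang" where
  "star_lang L =
    \<lparr>fsyms = {Meet}, farity = (\<lambda>_. 2),
     rsyms = insert Leq (Star ` rsyms L),
     rarity = (\<lambda>R. case R of Leq \<Rightarrow> 2 | Star R' \<Rightarrow> Suc (rarity L R'))\<rparr>"

abbreviation leq_fm :: "tree_fun tm \<Rightarrow> tree_fun tm \<Rightarrow> (tree_fun, 'r star_rel) fm" where
  "leq_fm s t \<equiv> Rel Leq [s, t]"

definition less_fm :: "tree_fun tm \<Rightarrow> tree_fun tm \<Rightarrow> (tree_fun, 'r star_rel) fm" where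
  "less_fm s t = Conj (leq_fm s t) (Neg (Eq s t))"

abbreviation meet_tm :: "tree_fun tm \<Rightarrow> tree_fun tm \<Rightarrow> tree_fun tm" where
  "meet_tm s t \<equiv> Fn Meet [s, t]"

definition tree_theory :: "(tree_fun, 'r star_rel) fm set" where
  "tree_theory =
    (let x = Var 0; y = Var 1; z = Var 2 in
     {Alls 1 (leq_fm x x),
      Alls 2 (Imp (Conj (leq_fm x y) (leq_fm y x)) (Eq x y)),
      Alls 3 (Imp (Conj (leq_fm x y) (leq_fm y z)) (leq_fm x z)),
      Alls 3 (Imp (Conj (leq_fm y x) (leq_fm z x)) (Disj (leq_fm y z) (leq_fm z y))),
      Alls 2 (Conj (leq_fm (meet_tm x y) x) (leq_fm (meet_tm x y) y)),
      Alls 3 (Imp (Conj (leq_fm z x) (leq_fm z y)) (leq_fm z (meet_tm x y)))})"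

text \<open>
  In \<open>star_fm \<psi>\<close> the new variable \<open>x\<close> is \<open>Var 0\<close>, and every variable of \<open>\<psi>\<close> is shifted up by one.
  The translation is only used for quantifier-free formulas of a relational language, so the
  clauses for \<open>Fn\<close> and \<open>All\<close> are irrelevant.
\<close>

fun star_tm :: "'f tm \<Rightarrow> tree_fun tm" where
  "star_tm (Var i) = Var (Suc i)"
| "star_tm (Fn f ts) = undefined"

fun star_fm :: "('f, 'r) fm \<Rightarrow> (tree_fun, 'r star_rel) fm" where
  "star_fm Bot = Bot"
| "star_fm (Eq s t) = less_fm (Var 0) (meet_tm (star_tm s) (star_tm t))"
| "star_fm (Rel R ts) = Rel (Star R) (Var 0 # map star_tm ts)"
| "star_fm (Imp \<phi> \<psi>) = Imp (star_fm \<phi>) (star_fm \<psi>)"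
| "star_fm (All i \<phi>) = undefined"

text \<open>The variables are \<open>x = Var 0\<close>, \<open>y\<^sub>i = Var (1 + i)\<close> and \<open>y'\<^sub>i = Var (1 + n + i)\<close>.\<close>

definition WD_axiom :: "nat \<Rightarrow> 'r \<Rightarrow> (tree_fun, 'r star_rel) fm" where
  "WD_axiom n R = Alls (1 + 2 * n)
    (Imp
      (Conj (Rel (Star R) (Var 0 # map (\<lambda>i. Var (1 + i)) [0..<n]))
        (Conjs (map (\<lambda>i. less_fm (Var 0) (meet_tm (Var (1 + i)) (Var (1 + n + i)))) [0..<n])))
      (Rel (Star R) (Var 0 # map (\<lambda>i. Var (1 + n + i)) [0..<n])))"

definition OC_axiom :: "nat \<Rightarrow> 'r \<Rightarrow> (tree_fun, 'r star_rel) fm" where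
  "OC_axiom n R = Alls (1 + n)
    (Imp (Rel (Star R) (Var 0 # map (\<lambda>i. Var (1 + i)) [0..<n]))
      (Conjs (map (\<lambda>i. less_fm (Var 0) (Var (1 + i))) [0..<n])))"

definition star_axiom :: "nat \<Rightarrow> ('f, 'r) fm \<Rightarrow> (tree_fun, 'r star_rel) fm" where
  "star_axiom n \<psi> = Alls (1 + n)
    (Imp (Conjs (map (\<lambda>i. less_fm (Var 0) (Var (1 + i))) [0..<n])) (star_fm \<psi>))"

definition star_theory ::
    "('f, 'r) lang \<Rightarrow> ('f, 'r) fm set \<Rightarrow> (tree_fun, 'r star_rel) fm set" where
  "star_theory L T = tree_theory \<union>
    {WD_axiom (rarity L R) R | R. R \<in> rsyms L} \<union>
    {OC_axiom (rarity L R) R | R. R \<in> rsyms L} \<union>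
    {star_axiom n \<psi> | n \<psi>. Alls n \<psi> \<in> T \<and> quantifier_free \<psi>}"


section \<open>Types and monster models\<close>

text \<open>
  A pair \<open>(\<phi>, bs)\<close> stands for the formula \<open>\<phi>(x\<^sub>0, \<dots>, x\<^bsub>n-1\<^esub>, bs)\<close> with parameters \<open>bs\<close>: \<open>Var i\<close> is
  the type variable \<open>x\<^sub>i\<close> for \<open>i < n\<close>, and \<open>Var (n + j)\<close> is the \<open>j\<close>-th parameter.
\<close>

type_synonym ('f, 'r, 'a) ptype = "(('f, 'r) fm \<times> 'a list) set"

definition par_fms :: "('f, 'r) lang \<Rightarrow> nat \<Rightarrow> 'a set \<Rightarrow> ('f, 'r, 'a) ptype" where
  "par_fms L n A =
    {(\<phi>, bs). is_fm L \<phi> \<and> set bs \<subseteq> A \<and> free_vars \<phi> \<subseteq> {..<n + length bs}}"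

definition realizes ::
    "('f, 'r, 'a) struct \<Rightarrow> nat \<Rightarrow> ('f, 'r, 'a) ptype \<Rightarrow> 'a list \<Rightarrow> bool" where
  "realizes C n \<Sigma> a \<longleftrightarrow> length a = n \<and> set a \<subseteq> univ C \<and>
    (\<forall>(\<phi>, bs)\<in>\<Sigma>. sat C (nth (a @ bs)) \<phi>)"

text \<open>Consistency is meant modulo the elementary diagram of \<open>C\<close>.\<close>

definition consistent :: "('f, 'r, 'a) struct \<Rightarrow> nat \<Rightarrow> ('f, 'r, 'a) ptype \<Rightarrow> bool" where
  "consistent C n \<Sigma> \<longleftrightarrow> (\<forall>\<Sigma>\<^sub>0. finite \<Sigma>\<^sub>0 \<and> \<Sigma>\<^sub>0 \<subseteq> \<Sigma> \<longrightarrow> (\<exists>a. realizes C n \<Sigma>\<^sub>0 a))"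

definition complete_type ::
    "('f, 'r) lang \<Rightarrow> ('f, 'r, 'a) struct \<Rightarrow> nat \<Rightarrow> 'a set \<Rightarrow> ('f, 'r, 'a) ptype \<Rightarrow> bool" where
  "complete_type L C n A q \<longleftrightarrow> q \<subseteq> par_fms L n A \<and> consistent C n q \<and>
    (\<forall>(\<phi>, bs)\<in>par_fms L n A. (\<phi>, bs) \<in> q \<or> (Neg \<phi>, bs) \<in> q)"

definition saturated ::
    "('f, 'r) lang \<Rightarrow> 'k rel \<Rightarrow> ('f, 'r, 'a) struct \<Rightarrow> bool" where
  "saturated L \<kappa> C \<longleftrightarrow> (\<forall>A n \<Sigma>. A \<subseteq> univ C \<and> |A| <o \<kappa> \<and>
    \<Sigma> \<subseteq> par_fms L n A \<and> consistent C n \<Sigma> \<longrightarrow> (\<exists>a. realizes C n \<Sigma> a))"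

definition elementary_map ::
    "('f, 'r) lang \<Rightarrow> ('f, 'r, 'a) struct \<Rightarrow> 'a set \<Rightarrow> ('a \<Rightarrow> 'a) \<Rightarrow> bool" where
  "elementary_map L C A h \<longleftrightarrow> h ` A \<subseteq> univ C \<and>
    (\<forall>(\<phi>, bs)\<in>par_fms L 0 A. sat C (nth bs) \<phi> = sat C (nth (map h bs)) \<phi>)"

definition strongly_homogeneous ::
    "('f, 'r) lang \<Rightarrow> 'k rel \<Rightarrow> ('f, 'r, 'a) struct \<Rightarrow> bool" where
  "strongly_homogeneous L \<kappa> C \<longleftrightarrow> (\<forall>A h. A \<subseteq> univ C \<and> |A| <o \<kappa> \<and> elementary_map L C A h \<longrightarrow>
    (\<exists>g. isomorphism L C C g \<and> (\<forall>x\<in>A. g x = h x)))"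

definition monster_model ::
    "('f, 'r) lang \<Rightarrow> 'k rel \<Rightarrow> ('f, 'r, 'a) struct \<Rightarrow> ('f, 'r, 'a) struct \<Rightarrow> bool" where
  "monster_model L \<kappa> M C \<longleftrightarrow> elementary_substruct L M C \<and>
    Card_order \<kappa> \<and> natLeq <o \<kappa> \<and> |univ M| <o \<kappa> \<and>
    saturated L \<kappa> C \<and> strongly_homogeneous L \<kappa> C"


section \<open>Indiscernible sequences and the properties of types\<close>

text \<open>
  A sequence of \<open>m\<close>-tuples is a function \<open>a\<close> on a set \<open>I\<close> of indices in a linear order.
\<close>

definition indiscernible ::
    "('f, 'r) lang \<Rightarrow> ('f, 'r, 'a) struct \<Rightarrow> 'a set \<Rightarrow> nat \<Rightarrow> 'i::linorder set \<Rightarrow>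
      ('i \<Rightarrow> 'a list) \<Rightarrow> bool" where
  "indiscernible L C A m I a \<longleftrightarrow>
    (\<forall>i\<in>I. length (a i) = m \<and> set (a i) \<subseteq> univ C) \<and>
    (\<forall>is js. set is \<subseteq> I \<and> set js \<subseteq> I \<and> sorted_wrt (<) is \<and> sorted_wrt (<) js \<and>
      length is = length js \<longrightarrow>
      (\<forall>(\<phi>, bs)\<in>par_fms L (length is * m) A.
        sat C (nth (concat (map a is) @ bs)) \<phi> = sat C (nth (concat (map a js) @ bs)) \<phi>))"

definition mutually_indiscernible ::
    "('f, 'r) lang \<Rightarrow> ('f, 'r, 'a) struct \<Rightarrow> 'a set \<Rightarrow>
      nat \<Rightarrow> 'i::linorder set \<Rightarrow> ('i \<Rightarrow> 'a list) \<Rightarrow>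
      nat \<Rightarrow> 'j::linorder set \<Rightarrow> ('j \<Rightarrow> 'a list) \<Rightarrow> bool" where
  "mutually_indiscernible L C A m\<^sub>0 I\<^sub>0 a\<^sub>0 m\<^sub>1 I\<^sub>1 a\<^sub>1 \<longleftrightarrow>
    indiscernible L C (A \<union> (\<Union>j\<in>I\<^sub>1. set (a\<^sub>1 j))) m\<^sub>0 I\<^sub>0 a\<^sub>0 \<and>
    indiscernible L C (A \<union> (\<Union>i\<in>I\<^sub>0. set (a\<^sub>0 i))) m\<^sub>1 I\<^sub>1 a\<^sub>1"

definition no_endpoints :: "'i::linorder set \<Rightarrow> bool" where
  "no_endpoints I \<longleftrightarrow> (\<forall>i\<in>I. (\<exists>j\<in>I. j < i) \<and> (\<exists>j\<in>I. i < j))"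

text \<open>\<open>I\<close> has the shape \<open>I\<^sub>1 + k + I\<^sub>2\<close> with \<open>I\<^sub>1\<close> and \<open>I\<^sub>2\<close> infinite without endpoints.\<close>

definition splits_at :: "'i::linorder set \<Rightarrow> 'i \<Rightarrow> bool" where
  "splits_at I k \<longleftrightarrow> k \<in> I \<and>
    infinite {i \<in> I. i < k} \<and> no_endpoints {i \<in> I. i < k} \<and>
    infinite {i \<in> I. k < i} \<and> no_endpoints {i \<in> I. k < i}"

text \<open>
  The index orders of the sequences range over subsets of the types given as \<open>itself\<close> arguments;
  a statement that leaves these types arbitrary is about all linear orders.
\<close>

definition dp_minimal ::
    "'i::linorder itself \<Rightarrow> 'j::linorder itself \<Rightarrow>
      ('f, 'r) lang \<Rightarrow> ('f, 'r, 'a) struct \<Rightarrow> 'a set \<Rightarrow> nat \<Rightarrow> ('f, 'r, 'a) ptype \<Rightarrow> bool" where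
  "dp_minimal _ _ L C A n \<Sigma> \<longleftrightarrow>
    (\<forall>m\<^sub>0 (I\<^sub>0 :: 'i set) a\<^sub>0 m\<^sub>1 (I\<^sub>1 :: 'j set) a\<^sub>1 b.
      infinite I\<^sub>0 \<and> infinite I\<^sub>1 \<and> mutually_indiscernible L C A m\<^sub>0 I\<^sub>0 a\<^sub>0 m\<^sub>1 I\<^sub>1 a\<^sub>1 \<and>
      realizes C n \<Sigma> b \<longrightarrow>
      indiscernible L C (set b \<union> A) m\<^sub>0 I\<^sub>0 a\<^sub>0 \<or> indiscernible L C (set b \<union> A) m\<^sub>1 I\<^sub>1 a\<^sub>1)"

definition distal ::
    "'i::linorder itself \<Rightarrow>
      ('f, 'r) lang \<Rightarrow> ('f, 'r, 'a) struct \<Rightarrow> nat \<Rightarrow> ('f, 'r, 'a) ptype \<Rightarrow> bool" where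
  "distal _ L C n \<Sigma> \<longleftrightarrow>
    (\<forall>d (I :: 'i set) k a.
      set d \<subseteq> univ C \<and> splits_at I k \<and> indiscernible L C {} n I a \<and>
      (\<forall>i\<in>I. realizes C n \<Sigma> (a i)) \<longrightarrow>
      (indiscernible L C (set d) n (I - {k}) a \<longleftrightarrow> indiscernible L C (set d) n I a))"

definition co_distal ::
    "'i::linorder itself \<Rightarrow>
      ('f, 'r) lang \<Rightarrow> ('f, 'r, 'a) struct \<Rightarrow> 'a set \<Rightarrow> nat \<Rightarrow> ('f, 'r, 'a) ptype \<Rightarrow> bool" where
  "co_distal _ L C A n \<Sigma> \<longleftrightarrow>
    (\<forall>d m (I :: 'i set) k a.
      realizes C n \<Sigma> d \<and> splits_at I k \<and> indiscernible L C A m I a \<and>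
      indiscernible L C (A \<union> set d) m (I - {k}) a \<longrightarrow>
      indiscernible L C (A \<union> set d) m I a)"

text \<open>
  In the formula \<open>\<phi>(x, y)\<close> the variables \<open>y\<close> are \<open>Var 0, \<dots>, Var (m - 1)\<close> and are followed by the
  variables \<open>x\<close>, so that \<open>(\<phi>, a)\<close> stands for \<open>\<phi>(a, y)\<close>.
\<close>

definition IP ::
    "('f, 'r) lang \<Rightarrow> ('f, 'r, 'a) struct \<Rightarrow> nat \<Rightarrow> ('f, 'r, 'a) ptype \<Rightarrow> bool" where
  "IP L C n \<pi> \<longleftrightarrow>
    (\<exists>\<phi> m. \<exists>a :: nat \<Rightarrow> 'a list.
      is_fm L \<phi> \<and> free_vars \<phi> \<subseteq> {..<m + n} \<and> (\<forall>i. realizes C n \<pi> (a i)) \<and>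
      (\<forall>s. consistent C m ({(\<phi>, a i) | i. i \<in> s} \<union> {(Neg \<phi>, a i) | i. i \<notin> s})))"

definition NIP ::
    "('f, 'r) lang \<Rightarrow> ('f, 'r, 'a) struct \<Rightarrow> nat \<Rightarrow> ('f, 'r, 'a) ptype \<Rightarrow> bool" where
  "NIP L C n \<pi> \<longleftrightarrow> \<not> IP L C n \<pi>"


section \<open>Branches\<close>

definition branch :: "(tree_fun, 'r star_rel, 'a) struct \<Rightarrow> 'a set \<Rightarrow> bool" where
  "branch M B \<longleftrightarrow> pred_on.maxchain (univ M) (\<lambda>x y. rint M Leq [x, y]) B"

definition above_type :: "'a set \<Rightarrow> (tree_fun, 'r star_rel, 'a) ptype" where
  "above_type B = {(less_fm (Var 1) (Var 0), [b]) | b. b \<in> B}"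

definition below_type :: "'a \<Rightarrow> (tree_fun, 'r star_rel, 'a) ptype" where
  "below_type c = {(less_fm (Var 0) (Var 1), [c])}"

end

theory Submission
  imports Defs
begin

text \<open>
  The point of the proof is that the points of the chain \<open>{x. x < c}\<close> are related to the rest of the
  model by very little besides the order. An element \<open>t\<close> meets a point \<open>x < c\<close> in the smaller of \<open>x\<close>
  and the projection \<open>t \<and> c\<close>. If \<open>x < t \<and> c\<close>, then \<open>t\<close> lies in the same open cone above \<open>x\<close> as \<open>c\<close>,
  and by (WD) no relation \<open>R\<^sup>*(x, \<dots>)\<close> distinguishes \<open>t\<close> from \<open>c\<close>; by (OC) the elements that are not
  above \<open>x\<close> do not occur in such relations at all. So if \<open>x\<close> is not itself a projection of a parameter,
  its type over the parameters is given by its cut among their projections and by its colour, the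
  truth values of the formulas \<open>R\<^sup>*(x, c, \<dots>, c)\<close>. Conversely, if \<open>x\<close> is a projection, then it is
  definable from that parameter and \<open>c\<close>. This is \<open>partial_embedding_move\<close>, combined with quantifier
  elimination for \<open>T\<^sup>*\<close> in the form \<open>partial_embedding_sat\<close>: a map between meet-closed sets that
  preserves the atomic formulas preserves all formulas.

  Let \<open>b < c\<close> and let \<open>I\<close> be a sequence of tuples that is indiscernible over a set containing \<open>c\<close>. By
  the above, \<open>I\<close> stays indiscernible after adding \<open>b\<close> as soon as \<open>b\<close> does not separate, for any
  coordinate \<open>s\<close>, the projections to the chain of the \<open>s\<close>-th coordinates of the tuples
  (\<open>indiscernible_insert_below\<close>). Co-distality follows, because the projections of one coordinate
  form a monotone sequence, so that the position of the middle term relative to \<open>b\<close> is the position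
  of its neighbours. For dp-minimality, two mutually indiscernible sequences of projections lie
  entirely on one side of each other, so that \<open>b\<close> cannot separate both.

  For distality the sequence \<open>I\<close> itself consists of points of the chain and is constant or strictly
  monotone. If deleting a middle term makes \<open>I\<close> indiscernible over \<open>d\<close>, no projection of an element of \<open>d\<close>
  falls into the range of \<open>I\<close>, so the points of \<open>I\<close> can be moved to each other over \<open>d\<close>.
  Finally, a formula with the independence property would pick out every second point of arbitrarily
  long finite monochromatic subsets of the chain, but \<open>m\<close> parameters have at most \<open>m\<close> projections and
  so cannot separate all consecutive pairs. Since \<open>\<pi>\<close> contains \<open>x < c\<close>, and the arguments allow
  arbitrary additional parameters, they apply to \<open>\<pi>\<close> as well.
\<close>

section \<open>Satisfaction\<close>

lemma sat_Neg [simp]: "sat A e (Neg \<phi>) \<longleftrightarrow> \<not> sat A e \<phi>"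
  by (simp add: Neg_def)

lemma sat_Conj [simp]: "sat A e (Conj \<phi> \<psi>) \<longleftrightarrow> sat A e \<phi> \<and> sat A e \<psi>"
  by (simp add: Conj_def)

lemma sat_Disj [simp]: "sat A e (Disj \<phi> \<psi>) \<longleftrightarrow> sat A e \<phi> \<or> sat A e \<psi>"
  by (auto simp add: Disj_def)

lemma sat_Conjs [simp]: "sat A e (Conjs \<phi>s) \<longleftrightarrow> (\<forall>\<phi>\<in>set \<phi>s. sat A e \<phi>)"
  by (induction \<phi>s) (auto simp: Conjs_def)

lemma free_vars_connectives [simp]:
  "free_vars (Neg \<phi>) = free_vars \<phi>"
  "free_vars (Conj \<phi> \<psi>) = free_vars \<phi> \<union> free_vars \<psi>"
  "free_vars (Disj \<phi> \<psi>) = free_vars \<phi> \<union> free_vars \<psi>"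
  by (auto simp: Neg_def Conj_def Disj_def)

lemma free_vars_Conjs [simp]: "free_vars (Conjs \<phi>s) = (\<Union>\<phi>\<in>set \<phi>s. free_vars \<phi>)"
  by (induction \<phi>s) (auto simp: Conjs_def)

lemma is_fm_connectives [simp]:
  "is_fm L (Neg \<phi>) \<longleftrightarrow> is_fm L \<phi>"
  "is_fm L (Conj \<phi> \<psi>) \<longleftrightarrow> is_fm L \<phi> \<and> is_fm L \<psi>"
  "is_fm L (Disj \<phi> \<psi>) \<longleftrightarrow> is_fm L \<phi> \<and> is_fm L \<psi>"
  by (auto simp: Neg_def Conj_def Disj_def)

lemma is_fm_Conjs [simp]: "is_fm L (Conjs \<phi>s) \<longleftrightarrow> (\<forall>\<phi>\<in>set \<phi>s. is_fm L \<phi>)"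
  by (induction \<phi>s) (auto simp: Conjs_def)

lemma quantifier_free_connectives [simp]:
  "quantifier_free (Neg \<phi>) \<longleftrightarrow> quantifier_free \<phi>"
  "quantifier_free (Conj \<phi> \<psi>) \<longleftrightarrow> quantifier_free \<phi> \<and> quantifier_free \<psi>"
  "quantifier_free (Disj \<phi> \<psi>) \<longleftrightarrow> quantifier_free \<phi> \<and> quantifier_free \<psi>"
  by (auto simp: Neg_def Conj_def Disj_def)

lemma quantifier_free_Conjs [simp]:
  "quantifier_free (Conjs \<phi>s) \<longleftrightarrow> (\<forall>\<phi>\<in>set \<phi>s. quantifier_free \<phi>)"
  by (induction \<phi>s) (auto simp: Conjs_def)

lemma eval_tm_cong: "(\<And>i. i \<in> tm_vars t \<Longrightarrow> e i = e' i) \<Longrightarrow> eval_tm A e t = eval_tm A e' t"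
proof (induction t)
  case (Fn f ts)
  have "map (eval_tm A e) ts = map (eval_tm A e') ts"
    by (rule map_cong[OF refl], rule Fn.IH) (use Fn.prems in auto)
  then show ?case by (simp only: eval_tm.simps)
qed simp

lemma sat_cong: "(\<And>i. i \<in> free_vars \<phi> \<Longrightarrow> e i = e' i) \<Longrightarrow> sat A e \<phi> = sat A e' \<phi>"
proof (induction \<phi> arbitrary: e e')
  case (Eq s t)
  then have "eval_tm A e s = eval_tm A e' s" "eval_tm A e t = eval_tm A e' t"
    by (auto intro!: eval_tm_cong)
  then show ?case by simp
next
  case (Rel R ts)
  have "map (eval_tm A e) ts = map (eval_tm A e') ts"
    by (rule map_cong[OF refl], rule eval_tm_cong) (use Rel in auto)
  then show ?case by (simp only: sat.simps)
next
  case (Imp \<phi> \<psi>)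
  have "sat A e \<phi> = sat A e' \<phi>" by (rule Imp.IH) (use Imp.prems in auto)
  moreover have "sat A e \<psi> = sat A e' \<psi>" by (rule Imp.IH) (use Imp.prems in auto)
  ultimately show ?case by simp
next
  case (All i \<phi>)
  have "sat A (e(i := x)) \<phi> = sat A (e'(i := x)) \<phi>" for x
    by (rule All.IH) (use All.prems in auto)
  then show ?case by simp
qed simp

lemma Alls_0 [simp]: "Alls 0 \<phi> = \<phi>" and Alls_Suc: "Alls (Suc n) \<phi> = Alls n (All n \<phi>)"
  by (simp_all add: Alls_def)

lemma is_fm_Alls [simp]: "is_fm L (Alls n \<phi>) = is_fm L \<phi>"
  by (induction n arbitrary: \<phi>) (auto simp: Alls_Suc)

lemma free_vars_Alls [simp]: "free_vars (Alls n \<phi>) = free_vars \<phi> - {..<n}"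
  by (induction n arbitrary: \<phi>) (auto simp: Alls_Suc)

lemma sat_Alls:
  "sat A e (Alls n \<phi>) \<longleftrightarrow>
    (\<forall>e'. (\<forall>i<n. e' i \<in> univ A) \<and> (\<forall>i\<ge>n. e' i = e i) \<longrightarrow> sat A e' \<phi>)"
proof (induction n arbitrary: \<phi>)
  case 0
  have "e' = e" if "\<forall>i. e' i = e i" for e' using that by blast
  then show ?case by auto
next
  case (Suc n)
  show ?case (is "?l \<longleftrightarrow> ?r")
  proof
    assume l: ?l
    show ?r
    proof (intro allI impI, elim conjE)
      fix e' assume e': "\<forall>i<Suc n. e' i \<in> univ A" "\<forall>i\<ge>Suc n. e' i = e i"
      have "sat A (e'(n := e n)) (All n \<phi>)"
        using l[unfolded Alls_Suc Suc.IH, rule_format, of "e'(n := e n)"] e'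
        by (auto simp: Suc_le_eq)
      then have "\<forall>x\<in>univ A. sat A (e'(n := x)) \<phi>" by simp
      then have "sat A (e'(n := e' n)) \<phi>" using e'(1) by blast
      then show "sat A e' \<phi>" by simp
    qed
  next
    assume r: ?r
    show ?l unfolding Alls_Suc Suc.IH
    proof (intro allI impI, elim conjE)
      fix e' assume e': "\<forall>i<n. e' i \<in> univ A" "\<forall>i\<ge>n. e' i = e i"
      have "sat A (e'(n := x)) \<phi>" if "x \<in> univ A" for x
        using r e' that by (auto simp: less_Suc_eq Suc_le_eq)
      then show "sat A e' (All n \<phi>)" by simp
    qed
  qed
qed

lemma models_Alls:
  assumes "univ A \<noteq> {}" "free_vars \<phi> \<subseteq> {..<n}"
  shows "models A {Alls n \<phi>} \<longleftrightarrow> (\<forall>e. e ` {..<n} \<subseteq> univ A \<longrightarrow> sat A e \<phi>)"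
proof
  obtain a where a: "a \<in> univ A" using assms by blast
  assume m: "models A {Alls n \<phi>}"
  show "\<forall>e. e ` {..<n} \<subseteq> univ A \<longrightarrow> sat A e \<phi>"
  proof (intro allI impI)
    fix e assume e: "e ` {..<n} \<subseteq> univ A"
    let ?e = "\<lambda>i. if i < n then e i else a"
    have "range ?e \<subseteq> univ A" using e a by auto
    then have "sat A ?e (Alls n \<phi>)" using m by (auto simp: models_def)
    then have "\<forall>e'. (\<forall>i<n. e' i \<in> univ A) \<and> (\<forall>i\<ge>n. e' i = ?e i) \<longrightarrow> sat A e' \<phi>"
      unfolding sat_Alls .
    then have "(\<forall>i<n. ?e i \<in> univ A) \<and> (\<forall>i\<ge>n. ?e i = ?e i) \<longrightarrow> sat A ?e \<phi>" by (rule spec)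
    moreover have "?e i \<in> univ A" if "i < n" for i using e that by auto
    ultimately have "sat A ?e \<phi>" by blast
    moreover have "sat A ?e \<phi> = sat A e \<phi>"
      by (rule sat_cong) (use assms in auto)
    ultimately show "sat A e \<phi>" by simp
  qed
next
  assume s: "\<forall>e. e ` {..<n} \<subseteq> univ A \<longrightarrow> sat A e \<phi>"
  have "sat A e (Alls n \<phi>)" for e
    unfolding sat_Alls using s by (simp add: image_subset_iff)
  then show "models A {Alls n \<phi>}" by (simp add: models_def)
qed

lemma embedding_fint:
  assumes "embedding L A B h" "is_struct L A"
    and "f \<in> fsyms L" "xs \<in> lists (univ A)" "length xs = farity L f"
  shows "fint A f xs \<in> univ A" "h (fint A f xs) = fint B f (map h xs)"
proof -
  from assms(2-) show "fint A f xs \<in> univ A" unfolding is_struct_def by blast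
  from assms(1,3-) show "h (fint A f xs) = fint B f (map h xs)" unfolding embedding_def by blast
qed

lemma embedding_rint:
  assumes "embedding L A B h"
    and "R \<in> rsyms L" "xs \<in> lists (univ A)" "length xs = rarity L R"
  shows "rint B R (map h xs) = rint A R xs"
  using assms unfolding embedding_def by blast

lemma embedding_eval_tm:
  assumes "embedding L A B h" "is_struct L A"
  shows "is_tm L t \<Longrightarrow> e ` tm_vars t \<subseteq> univ A \<Longrightarrow>
    eval_tm A e t \<in> univ A \<and> eval_tm B (\<lambda>i. h (e i)) t = h (eval_tm A e t)"
proof (induction t)
  case (Fn f ts)
  have IH: "eval_tm A e t \<in> univ A \<and> eval_tm B (\<lambda>i. h (e i)) t = h (eval_tm A e t)" if "t \<in> set ts" for t
    using that Fn.prems by (intro Fn.IH) auto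
  have "map (eval_tm A e) ts \<in> lists (univ A)" using IH by auto
  moreover have "map (eval_tm B (\<lambda>i. h (e i))) ts = map h (map (eval_tm A e) ts)"
    using IH by simp
  moreover have "f \<in> fsyms L" "length (map (eval_tm A e) ts) = farity L f" using Fn.prems by auto
  ultimately show ?case using embedding_fint[OF assms] by (metis eval_tm.simps(2))
qed auto

text \<open>
  Surjectivity is used in the step for the universal quantifier. The two alternatives cover the transfer of
  a quantifier-free kernel to a substructure and the invariance of formulas under automorphisms.
\<close>

lemma embedding_sat:
  assumes h: "embedding L A B h" and A: "is_struct L A"
  shows "is_fm L \<phi> \<Longrightarrow> quantifier_free \<phi> \<or> h ` univ A = univ B \<Longrightarrow> e ` free_vars \<phi> \<subseteq> univ A \<Longrightarrow>
    sat B (\<lambda>i. h (e i)) \<phi> = sat A e \<phi>"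
proof (induction \<phi> arbitrary: e)
  case (Eq s t)
  have "eval_tm A e s \<in> univ A \<and> eval_tm B (\<lambda>i. h (e i)) s = h (eval_tm A e s)"
    "eval_tm A e t \<in> univ A \<and> eval_tm B (\<lambda>i. h (e i)) t = h (eval_tm A e t)"
    using Eq by (auto intro!: embedding_eval_tm[OF h A])
  moreover have "inj_on h (univ A)" using h by (simp add: embedding_def)
  ultimately show ?case by (simp add: inj_on_eq_iff)
next
  case (Rel R ts)
  have t: "eval_tm A e t \<in> univ A \<and> eval_tm B (\<lambda>i. h (e i)) t = h (eval_tm A e t)" if "t \<in> set ts" for t
    using Rel that by (intro embedding_eval_tm[OF h A]) auto
  have "map (eval_tm A e) ts \<in> lists (univ A)" using t by auto
  moreover have "map (eval_tm B (\<lambda>i. h (e i))) ts = map h (map (eval_tm A e) ts)"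
    using t by simp
  moreover have "R \<in> rsyms L" "length (map (eval_tm A e) ts) = rarity L R" using Rel by auto
  ultimately show ?case using embedding_rint[OF h] by (metis sat.simps(3))
next
  case (Imp \<phi> \<psi>)
  have "sat B (\<lambda>i. h (e i)) \<phi> = sat A e \<phi>" "sat B (\<lambda>i. h (e i)) \<psi> = sat A e \<psi>"
    by (intro Imp.IH; use Imp.prems in auto)+
  then show ?case by simp
next
  case (All i \<phi>)
  then have s: "h ` univ A = univ B" by auto
  have "sat B ((\<lambda>i. h (e i))(i := h x)) \<phi> = sat A (e(i := x)) \<phi>" if x: "x \<in> univ A" for x
  proof -
    have "sat B (\<lambda>j. h ((e(i := x)) j)) \<phi> = sat A (e(i := x)) \<phi>"
      by (rule All.IH) (use All.prems x in auto)
    moreover have "(\<lambda>j. h ((e(i := x)) j)) = (\<lambda>i. h (e i))(i := h x)" by auto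
    ultimately show ?thesis by simp
  qed
  then show ?case by (auto simp: s[symmetric])
qed auto

section \<open>Universal sentences in a Fraisse limit\<close>

text \<open>
  The members of the age have universes of natural numbers, so the substructure generated by \<open>X\<close> is
  copied along an enumeration of \<open>N\<close>.
\<close>

lemma age_covers_finite:
  fixes N :: "('f, 'r, 'n) struct"
  assumes N: "is_struct L N" and cnt: "countable (univ N)"
    and X: "finite X" "X \<subseteq> univ N" "X \<noteq> {}"
  shows "\<exists>A\<in>age L N. \<exists>k. embedding L A N k \<and> X \<subseteq> k ` univ A"
proof -
  define F where "F = {S. X \<subseteq> S \<and> S \<subseteq> univ N \<and> is_struct L (restrict_to N S)}"
  define S where "S = \<Inter>F"
  have "univ N \<in> F" using X N by (auto simp: F_def restrict_to_def)
  then have SN: "S \<subseteq> univ N" by (auto simp: S_def)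
  have XS: "X \<subseteq> S" by (auto simp: S_def F_def)
  have Scl: "fint N f xs \<in> S" if "f \<in> fsyms L" "xs \<in> lists S" "length xs = farity L f" for f xs
    unfolding S_def
  proof
    fix S' assume S': "S' \<in> F"
    then have "xs \<in> lists S'" using that by (auto simp: S_def)
    then show "fint N f xs \<in> S'"
      using S' that by (auto simp: F_def is_struct_def restrict_to_def)
  qed
  define \<iota> where "\<iota> = to_nat_on (univ N)"
  define \<kappa> where "\<kappa> = from_nat_into (univ N)"
  have \<kappa>\<iota>: "\<kappa> (\<iota> x) = x" if "x \<in> univ N" for x
    using cnt that by (simp add: \<kappa>_def \<iota>_def)
  define A :: "('f, 'r, nat) struct" where
    "A = \<lparr>univ = \<iota> ` S, fint = \<lambda>f xs. \<iota> (fint N f (map \<kappa> xs)), rint = \<lambda>R xs. rint N R (map \<kappa> xs)\<rparr>"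
  have \<kappa>S: "map \<kappa> xs \<in> lists S" if "xs \<in> lists (\<iota> ` S)" for xs
  proof -
    have "\<kappa> x \<in> S" if "x \<in> \<iota> ` S" for x using that SN \<kappa>\<iota> by (metis image_iff subsetD)
    then show ?thesis using that by auto
  qed
  have A: "is_struct L A"
    using XS X Scl \<kappa>S by (auto simp: is_struct_def A_def)
  have emb: "embedding L A N \<kappa>"
    unfolding embedding_def
  proof (intro conjI ballI impI)
    show "\<kappa> ` univ A \<subseteq> univ N" "inj_on \<kappa> (univ A)"
      using SN by (auto simp: A_def \<kappa>\<iota> subset_iff intro!: inj_onI)
    fix f xs assume "f \<in> fsyms L" "xs \<in> lists (univ A)" "length xs = farity L f"
    then have "fint N f (map \<kappa> xs) \<in> S"
      using \<kappa>S[of xs] by (intro Scl) (auto simp: A_def)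
    then show "\<kappa> (fint A f xs) = fint N f (map \<kappa> xs)"
      using SN by (auto simp: A_def \<kappa>\<iota> subset_iff)
  qed (auto simp: A_def)
  have "finitely_generated L A"
    unfolding finitely_generated_def
  proof (intro exI[of _ "\<iota> ` X"] conjI allI impI, goal_cases)
    case (3 S')
    then have S': "\<iota> ` X \<subseteq> S'" "S' \<subseteq> \<iota> ` S" "is_struct L (restrict_to A S')" by (auto simp: A_def)
    have "\<kappa> ` S' \<in> F"
    proof -
      have "X \<subseteq> \<kappa> ` S'" using S'(1) X \<kappa>\<iota> by (force simp: image_iff subset_iff)
      moreover have *: "\<kappa> ` S' \<subseteq> univ N" using S'(2) SN \<kappa>\<iota> by (auto simp: subset_iff)
      moreover have "is_struct L (restrict_to N (\<kappa> ` S'))"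
        unfolding is_struct_def
      proof (intro conjI ballI impI)
        show "univ (restrict_to N (\<kappa> ` S')) \<noteq> {}" using S'(1) X by (auto simp: restrict_to_def)
        fix f xs assume f: "f \<in> fsyms L" "xs \<in> lists (univ (restrict_to N (\<kappa> ` S')))"
          "length xs = farity L f"
        then obtain ys where ys: "xs = map \<kappa> ys" "ys \<in> lists S'"
          by (auto simp: restrict_to_def lists_image)
        then have "fint A f ys \<in> S'"
          using S'(3) f by (auto simp: is_struct_def restrict_to_def)
        moreover have "fint N f xs \<in> S"
          using ys f S'(2) \<kappa>S[of ys] by (intro Scl) auto
        then have "\<kappa> (fint A f ys) = fint N f xs" using ys SN by (auto simp: A_def \<kappa>\<iota> subset_iff)
        ultimately show "fint (restrict_to N (\<kappa> ` S')) f xs \<in> univ (restrict_to N (\<kappa> ` S'))"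
          by (auto simp: restrict_to_def intro: rev_image_eqI)
      qed
      ultimately show ?thesis by (auto simp: F_def)
    qed
    then have "S \<subseteq> \<kappa> ` S'" by (auto simp: S_def)
    then have "\<iota> ` S \<subseteq> S'" using S'(2) SN \<kappa>\<iota> by (force simp: subset_iff image_iff)
    then show ?case using S'(2) by (auto simp: A_def)
  qed (use X XS in \<open>auto simp: A_def\<close>)
  then have "A \<in> age L N" using A emb by (auto simp: age_def)
  moreover have "X \<subseteq> \<kappa> ` univ A" using XS SN \<kappa>\<iota> by (force simp: A_def image_iff subset_iff)
  ultimately show ?thesis using emb by blast
qed

text \<open>
  A counterexample to a universal axiom would already appear in a finitely generated substructure,
  that is, in a member of the class.
\<close>

lemma fraisse_limit_models_universal:
  assumes N: "fraisse_limit L (finite_models L Th) N"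
    and \<psi>: "Alls n \<psi> \<in> Th" "quantifier_free \<psi>" "is_fm L \<psi>" "free_vars \<psi> \<subseteq> {..<n}"
  shows "models N {Alls n \<psi>}"
proof -
  have s: "is_struct L N" and c: "countable (univ N)" and age: "age L N = finite_models L Th"
    using N by (auto simp: fraisse_limit_def)
  have ne: "univ N \<noteq> {}" using s by (auto simp: is_struct_def)
  show ?thesis unfolding models_Alls[OF ne \<psi>(4)]
  proof (intro allI impI)
    fix e assume e: "e ` {..<n} \<subseteq> univ N"
    obtain a where a: "a \<in> univ N" using ne by blast
    have "\<exists>A\<in>age L N. \<exists>k. embedding L A N k \<and> insert a (e ` {..<n}) \<subseteq> k ` univ A"
      using a e by (intro age_covers_finite s c) auto
    then obtain A k where A: "A \<in> age L N" and k: "embedding L A N k" "insert a (e ` {..<n}) \<subseteq> k ` univ A"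
      by blast
    have sA: "is_struct L A" and m: "models A Th" using A age by (auto simp: finite_models_def)
    have neA: "univ A \<noteq> {}" using sA by (auto simp: is_struct_def)
    define e' where "e' i = inv_into (univ A) k (e i)" for i
    have e': "e' i \<in> univ A" "k (e' i) = e i" if "i < n" for i
      using k(2) that by (auto simp: e'_def intro!: inv_into_into f_inv_into_f)
    have "models A {Alls n \<psi>}" using m \<psi> by (auto simp: models_def)
    then have "sat A e' \<psi>"
      using e' by (auto simp: models_Alls[OF neA \<psi>(4)])
    then have "sat N (\<lambda>i. k (e' i)) \<psi>"
      using embedding_sat[OF k(1) sA \<psi>(3), of e'] \<psi> e' by auto
    moreover have "sat N (\<lambda>i. k (e' i)) \<psi> = sat N e \<psi>"
      by (rule sat_cong) (use \<psi>(4) e' in auto)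
    ultimately show "sat N e \<psi>" by simp
  qed
qed

section \<open>Treelike structures\<close>

lemma star_lang_simps [simp]:
  "fsyms (star_lang L) = {Meet}" "farity (star_lang L) f = 2"
  "rsyms (star_lang L) = insert Leq (Star ` rsyms L)"
  "rarity (star_lang L) Leq = 2" "rarity (star_lang L) (Star R) = Suc (rarity L R)"
  by (simp_all add: star_lang_def)

text \<open>
  The theory \<open>star_theory L {}\<close> consists of the axioms of meet-trees together with (WD) and (OC);
  it is contained in \<open>star_theory L T\<close> for every \<open>T\<close>.
\<close>

locale treelike_struct =
  fixes L :: "('f, 'r) lang" and A :: "(tree_fun, 'r star_rel, 'a) struct"
  assumes struct: "is_struct (star_lang L) A" and star_models: "models A (star_theory L {})"
begin

abbreviation U :: "'a set" where "U \<equiv> univ A"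

abbreviation le :: "'a \<Rightarrow> 'a \<Rightarrow> bool" (infix "\<sqsubseteq>" 50) where "x \<sqsubseteq> y \<equiv> rint A Leq [x, y]"

abbreviation meet :: "'a \<Rightarrow> 'a \<Rightarrow> 'a" (infixl "\<sqinter>" 70) where "x \<sqinter> y \<equiv> fint A Meet [x, y]"

definition less :: "'a \<Rightarrow> 'a \<Rightarrow> bool" (infix "\<sqsubset>" 50) where "x \<sqsubset> y \<longleftrightarrow> x \<sqsubseteq> y \<and> x \<noteq> y"

lemma nonempty: "U \<noteq> {}"
  using struct by (simp add: is_struct_def)

lemma sat_less [simp]: "sat A e (less_fm s t) \<longleftrightarrow> eval_tm A e s \<sqsubset> eval_tm A e t"
  by (simp add: less_fm_def less_def)

lemma axiom:
  assumes "Alls n \<phi> \<in> star_theory L {}" "free_vars \<phi> \<subseteq> {..<n}" "e ` {..<n} \<subseteq> U"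
  shows "sat A e \<phi>"
  using star_models assms models_Alls[OF nonempty assms(2)] by (auto simp: models_def)

lemma meet_in [simp, intro]: "x \<in> U \<Longrightarrow> y \<in> U \<Longrightarrow> x \<sqinter> y \<in> U"
  using struct by (auto simp: is_struct_def)

lemma le_refl [simp]: "x \<in> U \<Longrightarrow> x \<sqsubseteq> x"
  using axiom[of 1 "leq_fm (Var 0) (Var 0)" "\<lambda>_. x"]
  by (auto simp: star_theory_def tree_theory_def Let_def)

lemma le_antisym: "\<lbrakk>x \<sqsubseteq> y; y \<sqsubseteq> x; x \<in> U; y \<in> U\<rbrakk> \<Longrightarrow> x = y"
  using axiom[of 2 "Imp (Conj (leq_fm (Var 0) (Var 1)) (leq_fm (Var 1) (Var 0))) (Eq (Var 0) (Var 1))"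
      "(\<lambda>_. x)(1 := y)"]
  by (auto simp: star_theory_def tree_theory_def Let_def)

lemma le_trans [trans]: "\<lbrakk>x \<sqsubseteq> y; y \<sqsubseteq> z; x \<in> U; y \<in> U; z \<in> U\<rbrakk> \<Longrightarrow> x \<sqsubseteq> z"
  using axiom[of 3 "Imp (Conj (leq_fm (Var 0) (Var 1)) (leq_fm (Var 1) (Var 2))) (leq_fm (Var 0) (Var 2))"
      "(\<lambda>_. x)(1 := y, 2 := z)"]
  by (auto simp: star_theory_def tree_theory_def Let_def)

lemma le_linear_below: "\<lbrakk>y \<sqsubseteq> x; z \<sqsubseteq> x; x \<in> U; y \<in> U; z \<in> U\<rbrakk> \<Longrightarrow> y \<sqsubseteq> z \<or> z \<sqsubseteq> y"
  using axiom[of 3 "Imp (Conj (leq_fm (Var 1) (Var 0)) (leq_fm (Var 2) (Var 0)))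
      (Disj (leq_fm (Var 1) (Var 2)) (leq_fm (Var 2) (Var 1)))" "(\<lambda>_. x)(1 := y, 2 := z)"]
  by (auto simp: star_theory_def tree_theory_def Let_def)

lemma meet_le: assumes "x \<in> U" "y \<in> U" shows "x \<sqinter> y \<sqsubseteq> x" "x \<sqinter> y \<sqsubseteq> y"
  using axiom[of 2 "Conj (leq_fm (meet_tm (Var 0) (Var 1)) (Var 0)) (leq_fm (meet_tm (Var 0) (Var 1)) (Var 1))"
      "(\<lambda>_. x)(1 := y)"] assms
  by (auto simp: star_theory_def tree_theory_def Let_def)

lemma meet_greatest: "\<lbrakk>z \<sqsubseteq> x; z \<sqsubseteq> y; x \<in> U; y \<in> U; z \<in> U\<rbrakk> \<Longrightarrow> z \<sqsubseteq> x \<sqinter> y"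
  using axiom[of 3 "Imp (Conj (leq_fm (Var 2) (Var 0)) (leq_fm (Var 2) (Var 1)))
      (leq_fm (Var 2) (meet_tm (Var 0) (Var 1)))" "(\<lambda>_. x)(1 := y, 2 := z)"]
  by (auto simp: star_theory_def tree_theory_def Let_def)

lemma well_defined:
  assumes R: "R \<in> rsyms L" "length ys = rarity L R"
    and xy: "rint A (Star R) (x # ys)" "list_all2 (\<lambda>y y'. x \<sqsubset> y \<sqinter> y') ys ys'"
    and U: "x \<in> U" "set ys \<subseteq> U" "set ys' \<subseteq> U"
  shows "rint A (Star R) (x # ys')"
proof -
  define n where "n = rarity L R"
  have len: "length ys = n" "length ys' = n" using R xy by (auto simp: n_def list_all2_lengthD)
  define e where "e = nth (x # ys @ ys')"
  define \<phi> where "\<phi> = Imp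
      (Conj (Rel (Star R) (Var 0 # map (\<lambda>i. Var (1 + i)) [0..<n]))
        (Conjs (map (\<lambda>i. less_fm (Var 0) (meet_tm (Var (1 + i)) (Var (1 + n + i)))) [0..<n])))
      (Rel (Star R) (Var 0 # map (\<lambda>i. Var (1 + n + i)) [0..<n]))"
  have ys: "map (\<lambda>i. e (Suc i)) [0..<n] = ys" "map (\<lambda>i. e (Suc (n + i))) [0..<n] = ys'"
    by (auto simp: e_def nth_append len intro!: nth_equalityI)
  have "sat A e \<phi>"
  proof (rule axiom)
    show "Alls (1 + 2 * n) \<phi> \<in> star_theory L {}"
      using R unfolding star_theory_def WD_axiom_def \<phi>_def n_def by auto
    show "free_vars \<phi> \<subseteq> {..<1 + 2 * n}"
      by (auto simp: \<phi>_def less_fm_def)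
    show "e ` {..<1 + 2 * n} \<subseteq> U"
      using U len by (auto simp: e_def nth_Cons nth_append subset_iff split: nat.split)
  qed
  moreover have "x \<sqsubset> e (Suc i) \<sqinter> e (Suc (n + i))" if "i < n" for i
    using xy(2) that len by (auto simp: list_all2_conv_all_nth e_def nth_append)
  moreover have "e 0 = x" by (simp add: e_def)
  ultimately show ?thesis
    using xy(1) by (simp add: \<phi>_def comp_def ys)
qed

lemma open_cone:
  assumes R: "R \<in> rsyms L" "length ys = rarity L R" and xy: "rint A (Star R) (x # ys)"
    and U: "x \<in> U" "set ys \<subseteq> U" and y: "y \<in> set ys"
  shows "x \<sqsubset> y"
proof -
  define n where "n = rarity L R"
  have len: "length ys = n" using R by (auto simp: n_def)
  define e where "e = nth (x # ys)"
  define \<phi> where "\<phi> = Imp (Rel (Star R) (Var 0 # map (\<lambda>i. Var (1 + i)) [0..<n]))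
      (Conjs (map (\<lambda>i. less_fm (Var 0) (Var (1 + i))) [0..<n]))"
  have ys: "map (\<lambda>i. e (Suc i)) [0..<n] = ys"
    by (auto simp: e_def len intro!: nth_equalityI)
  have "sat A e \<phi>"
  proof (rule axiom)
    show "Alls (1 + n) \<phi> \<in> star_theory L {}"
      using R unfolding star_theory_def OC_axiom_def \<phi>_def n_def by auto
    show "free_vars \<phi> \<subseteq> {..<1 + n}"
      by (auto simp: \<phi>_def less_fm_def)
    show "e ` {..<1 + n} \<subseteq> U"
      using U len by (auto simp: e_def nth_Cons subset_iff split: nat.split)
  qed
  then have "\<forall>i<n. x \<sqsubset> ys ! i"
    using xy by (auto simp: \<phi>_def comp_def ys) (simp_all add: e_def)
  then show ?thesis using y len by (auto simp: in_set_conv_nth)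
qed

text \<open>
  Both \<open>x \<sqinter> y\<close> and \<open>x \<sqinter> z\<close> lie below \<open>x\<close>, hence are comparable, and the smaller one is \<open>x \<sqinter> y \<sqinter> z\<close>.
\<close>

lemma meet_meet_cases:
  assumes "x \<in> U" "y \<in> U" "z \<in> U"
  shows "x \<sqinter> y \<sqinter> z = x \<sqinter> y \<or> x \<sqinter> y \<sqinter> z = x \<sqinter> z"
proof -
  have "x \<sqinter> y \<sqsubseteq> x \<sqinter> z \<or> x \<sqinter> z \<sqsubseteq> x \<sqinter> y"
    using assms meet_le le_linear_below by (meson meet_in)
  then show ?thesis
  proof
    assume "x \<sqinter> y \<sqsubseteq> x \<sqinter> z"
    then have "x \<sqinter> y \<sqsubseteq> x \<sqinter> y \<sqinter> z"
      using assms by (meson meet_greatest meet_in meet_le le_refl le_trans)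
    then show ?thesis using assms by (meson le_antisym meet_in meet_le)
  next
    assume "x \<sqinter> z \<sqsubseteq> x \<sqinter> y"
    then have "x \<sqinter> z \<sqsubseteq> x \<sqinter> y \<sqinter> z"
      using assms by (meson meet_greatest meet_in meet_le le_refl le_trans)
    moreover have "x \<sqinter> y \<sqinter> z \<sqsubseteq> x \<sqinter> z"
      using assms by (meson meet_greatest meet_in meet_le le_trans)
    ultimately show ?thesis using assms by (meson le_antisym meet_in)
  qed
qed

lemma meet_commute: "x \<in> U \<Longrightarrow> y \<in> U \<Longrightarrow> x \<sqinter> y = y \<sqinter> x"
  by (meson le_antisym meet_greatest meet_in meet_le)

lemma meet_absorb: "x \<in> U \<Longrightarrow> y \<in> U \<Longrightarrow> x \<sqsubseteq> y \<Longrightarrow> x \<sqinter> y = x"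
  by (meson le_antisym meet_greatest meet_in meet_le le_refl)

lemma meet_absorb2: "x \<in> U \<Longrightarrow> y \<in> U \<Longrightarrow> y \<sqsubseteq> x \<Longrightarrow> x \<sqinter> y = y"
  using meet_absorb meet_commute by metis

lemma le_meet_iff: "x \<in> U \<Longrightarrow> y \<in> U \<Longrightarrow> z \<in> U \<Longrightarrow> z \<sqsubseteq> x \<sqinter> y \<longleftrightarrow> z \<sqsubseteq> x \<and> z \<sqsubseteq> y"
  by (meson le_trans meet_greatest meet_in meet_le)

lemma meet_assoc: "x \<in> U \<Longrightarrow> y \<in> U \<Longrightarrow> z \<in> U \<Longrightarrow> x \<sqinter> y \<sqinter> z = x \<sqinter> (y \<sqinter> z)"
  by (rule le_antisym) (auto simp: le_meet_iff meet_le intro: le_trans meet_le)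

text \<open>
  In a tree the pairwise meets of a set are already closed under meets. This bounds the size of
  generated substructures and makes the set of atomic formulas below finite.
\<close>

lemma pair_meet_cases:
  assumes "x \<in> U" "y \<in> U" "z \<in> U" "w \<in> U"
  shows "x \<sqinter> y \<sqinter> (z \<sqinter> w) \<in> {x \<sqinter> y, x \<sqinter> z, x \<sqinter> w, y \<sqinter> w, z \<sqinter> w}"
proof -
  have "x \<sqinter> y \<sqinter> (z \<sqinter> w) = x \<sqinter> y \<sqinter> z \<sqinter> w" using assms by (simp add: meet_assoc)
  then show ?thesis
    using meet_meet_cases[of x y z] meet_meet_cases[of x y w] meet_meet_cases[of x z w] assms by auto
qed

section \<open>Partial embeddings\<close>

definition meet_closed :: "'a set \<Rightarrow> bool" where
  "meet_closed S \<longleftrightarrow> S \<subseteq> U \<and> (\<forall>x\<in>S. \<forall>y\<in>S. x \<sqinter> y \<in> S)"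

definition partial_embedding :: "'a set \<Rightarrow> ('a \<Rightarrow> 'a) \<Rightarrow> bool" where
  "partial_embedding S h \<longleftrightarrow> meet_closed S \<and> h ` S \<subseteq> U \<and>
    (\<forall>x\<in>S. \<forall>y\<in>S. h (x \<sqinter> y) = h x \<sqinter> h y) \<and>
    (\<forall>x\<in>S. \<forall>y\<in>S. x \<sqsubseteq> y \<longleftrightarrow> h x \<sqsubseteq> h y) \<and>
    (\<forall>R\<in>rsyms L. \<forall>x\<in>S. \<forall>ys\<in>lists S. length ys = rarity L R \<longrightarrow>
      rint A (Star R) (x # ys) = rint A (Star R) (h x # map h ys))"

lemma partial_embedding_inj:
  assumes "partial_embedding S h" shows "inj_on h S"
proof (rule inj_onI)
  fix x y assume "x \<in> S" "y \<in> S" "h x = h y"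
  then show "x = y"
    using assms unfolding partial_embedding_def meet_closed_def
    by (metis image_subset_iff le_antisym le_refl subsetD)
qed

end

definition meets :: "nat \<Rightarrow> tree_fun tm set" where
  "meets n = (\<lambda>(i, j). meet_tm (Var i) (Var j)) ` ({..<n} \<times> {..<n})"

text \<open>
  A finite set of atomic formulas that determines the isomorphism type of the substructure generated
  by \<open>n\<close> elements. Its elements are denoted by the terms in \<open>meets n\<close>, where \<open>x\<^sub>i\<close> itself is
  \<open>x\<^sub>i \<and> x\<^sub>i\<close>, and the equations \<open>s \<and> t = u\<close> describe its meet operation.
\<close>

definition atoms :: "('f, 'r) lang \<Rightarrow> nat \<Rightarrow> (tree_fun, 'r star_rel) fm set" where
  "atoms L n =
    (\<lambda>(s, t, u). Eq (meet_tm s t) u) ` (meets n \<times> meets n \<times> meets n) \<union>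
    (\<lambda>(s, t). leq_fm s t) ` (meets n \<times> meets n) \<union>
    (\<Union>R\<in>rsyms L. Rel (Star R) ` {ts. set ts \<subseteq> meets n \<and> length ts = Suc (rarity L R)})"

lemma finite_atoms: "finite (rsyms L) \<Longrightarrow> finite (atoms L n)"
  by (auto simp: atoms_def meets_def intro!: finite_lists_length_eq)

lemma is_fm_atoms: "\<theta> \<in> atoms L n \<Longrightarrow> is_fm (star_lang L) \<theta>"
  by (force simp: atoms_def meets_def subset_iff)

lemma free_vars_meets: "t \<in> meets n \<Longrightarrow> tm_vars t \<subseteq> {..<n}"
  by (auto simp: meets_def)

lemma free_vars_atoms: "\<theta> \<in> atoms L n \<Longrightarrow> free_vars \<theta> \<subseteq> {..<n}"
  unfolding atoms_def using free_vars_meets[of _ n] by (fastforce simp: subset_iff)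

context treelike_struct begin

lemma meets_closed:
  assumes e: "\<And>i. i < n \<Longrightarrow> e i \<in> U" and s: "s \<in> meets n" "t \<in> meets n"
  shows "\<exists>u\<in>meets n. eval_tm A e (meet_tm s t) = eval_tm A e u"
proof -
  obtain i j k l where ij: "s = meet_tm (Var i) (Var j)" "t = meet_tm (Var k) (Var l)"
    "i < n" "j < n" "k < n" "l < n" using s by (auto simp: meets_def)
  have "e i \<sqinter> e j \<sqinter> (e k \<sqinter> e l) \<in> {e i \<sqinter> e j, e i \<sqinter> e k, e i \<sqinter> e l, e j \<sqinter> e l, e k \<sqinter> e l}"
    using e ij by (intro pair_meet_cases) auto
  then show ?thesis using ij by (force simp: meets_def)
qed

text \<open>
  The map sends the value of a term in \<open>meets n\<close> under \<open>e\<close> to its value under \<open>e'\<close>.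
\<close>

lemma atoms_agree_partial_embedding:
  assumes e: "\<And>i. i < n \<Longrightarrow> e i \<in> U" "\<And>i. i < n \<Longrightarrow> e' i \<in> U"
    and agree: "\<And>\<theta>. \<theta> \<in> atoms L n \<Longrightarrow> sat A e \<theta> = sat A e' \<theta>"
  obtains h where "partial_embedding (eval_tm A e ` meets n) h"
    "\<And>i. i < n \<Longrightarrow> h (e i) = e' i"
    "\<And>t. t \<in> meets n \<Longrightarrow> h (eval_tm A e t) = eval_tm A e' t"
proof -
  have U: "eval_tm A e t \<in> U" "eval_tm A e' t \<in> U" if "t \<in> meets n" for t
    using that e by (auto simp: meets_def)
  have le: "eval_tm A e s \<sqsubseteq> eval_tm A e t \<longleftrightarrow> eval_tm A e' s \<sqsubseteq> eval_tm A e' t"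
    if "s \<in> meets n" "t \<in> meets n" for s t
  proof -
    have "leq_fm s t \<in> atoms L n" using that by (auto simp: atoms_def)
    then show ?thesis using agree by fastforce
  qed
  have eq: "eval_tm A e' s = eval_tm A e' t"
    if "s \<in> meets n" "t \<in> meets n" "eval_tm A e s = eval_tm A e t" for s t
    using le[of s t] le[of t s] that U by (metis le_antisym le_refl)
  define h where "h x = eval_tm A e' (SOME t. t \<in> meets n \<and> eval_tm A e t = x)" for x
  have h: "h (eval_tm A e t) = eval_tm A e' t" if "t \<in> meets n" for t
    unfolding h_def using that by (intro eq; use someI_ex[of "\<lambda>s. s \<in> meets n \<and> eval_tm A e s = eval_tm A e t"] in auto)
  have mt: "eval_tm A e s \<sqinter> eval_tm A e t \<in> eval_tm A e ` meets n \<and>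
      h (eval_tm A e s \<sqinter> eval_tm A e t) = h (eval_tm A e s) \<sqinter> h (eval_tm A e t)"
    if st: "s \<in> meets n" "t \<in> meets n" for s t
  proof -
    obtain u where u: "u \<in> meets n" "eval_tm A e (meet_tm s t) = eval_tm A e u"
      using meets_closed[of n e s t] e(1) st by blast
    then have "Eq (meet_tm s t) u \<in> atoms L n" using st by (force simp: atoms_def)
    then have "eval_tm A e' (meet_tm s t) = eval_tm A e' u" using agree u by fastforce
    then show ?thesis using u h st by auto
  qed
  have rel: "rint A (Star R) (x # ys) = rint A (Star R) (h x # map h ys)"
    if R: "R \<in> rsyms L" "x \<in> eval_tm A e ` meets n" "ys \<in> lists (eval_tm A e ` meets n)"
      "length ys = rarity L R" for R x ys
  proof -
    obtain t ts where t: "x = eval_tm A e t" "ys = map (eval_tm A e) ts" "t \<in> meets n" "ts \<in> lists (meets n)"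
      using R by (auto simp: lists_image)
    have "Rel (Star R) (t # ts) \<in> atoms L n"
      unfolding atoms_def using t R by (intro UnI2 UN_I[of R] imageI) auto
    moreover have "map h ys = map (eval_tm A e') ts" using t h by auto
    ultimately show ?thesis using agree[of "Rel (Star R) (t # ts)"] t h by (simp del: map_map)
  qed
  have pe: "partial_embedding (eval_tm A e ` meets n) h"
    unfolding partial_embedding_def meet_closed_def using U h mt le rel by (auto simp: image_subset_iff)
  moreover have "h (e i) = e' i" if "i < n" for i
    using h[of "meet_tm (Var i) (Var i)"] that e by (force simp: meets_def meet_absorb)
  ultimately show thesis using that h by blast
qed

end

section \<open>Quantifier elimination\<close>

lemma star_theory_universal:
  assumes "\<sigma> \<in> star_theory L {}"
  obtains n \<psi> where "\<sigma> = Alls n \<psi>" "quantifier_free \<psi>" "is_fm (star_lang L) \<psi>" "free_vars \<psi> \<subseteq> {..<n}"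
proof -
  have "\<exists>n \<psi>. \<sigma> = Alls n \<psi> \<and> quantifier_free \<psi> \<and> is_fm (star_lang L) \<psi> \<and> free_vars \<psi> \<subseteq> {..<n}"
  proof -
    consider "\<sigma> \<in> tree_theory" | R where "R \<in> rsyms L" "\<sigma> = WD_axiom (rarity L R) R"
      | R where "R \<in> rsyms L" "\<sigma> = OC_axiom (rarity L R) R"
      using assms by (auto simp: star_theory_def)
    then show ?thesis
    proof cases
      case 1
      then show ?thesis unfolding tree_theory_def Let_def by (elim insertE; force)
    next
      case (2 R)
      show ?thesis
        by (rule exI, rule exI, rule conjI, rule 2(2)[unfolded WD_axiom_def])
          (use 2(1) in \<open>auto simp: less_fm_def\<close>)
    next
      case (3 R)
      show ?thesis
        by (rule exI, rule exI, rule conjI, rule 3(2)[unfolded OC_axiom_def])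
          (use 3(1) in \<open>auto simp: less_fm_def\<close>)
    qed
  qed
  then show thesis using that by blast
qed

lemma limit_is_treelike:
  assumes N: "fraisse_limit (star_lang L) (finite_models (star_lang L) (star_theory L T)) N"
  shows "treelike_struct L N"
proof
  show "is_struct (star_lang L) N" using N by (simp add: fraisse_limit_def)
  show "models N (star_theory L {})"
    unfolding models_def
  proof (intro ballI allI impI)
    fix \<sigma> and e :: "nat \<Rightarrow> _" assume \<sigma>: "\<sigma> \<in> star_theory L {}" and e: "range e \<subseteq> univ N"
    then obtain n \<psi> where \<psi>: "\<sigma> = Alls n \<psi>" "quantifier_free \<psi>" "is_fm (star_lang L) \<psi>"
      "free_vars \<psi> \<subseteq> {..<n}" using star_theory_universal by blast
    moreover have "\<sigma> \<in> star_theory L T" using \<sigma> by (auto simp: star_theory_def)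
    ultimately have "models N {\<sigma>}" using fraisse_limit_models_universal[OF N] by auto
    then show "sat N e \<sigma>" using e by (auto simp: models_def)
  qed
qed

text \<open>
  The isomorphism between the finite substructures generated by the two tuples extends to an
  automorphism. The tuples are nonempty because structures, hence the substructures to which
  ultrahomogeneity applies, have nonempty universes.
\<close>

lemma (in treelike_struct) ultrahomogeneous_atoms_determine:
  assumes hom: "ultrahomogeneous (star_lang L) A"
    and n: "0 < n" and e: "\<And>i. i < n \<Longrightarrow> e i \<in> univ A" "\<And>i. i < n \<Longrightarrow> e' i \<in> univ A"
    and agree: "\<And>\<theta>. \<theta> \<in> atoms L n \<Longrightarrow> sat A e \<theta> = sat A e' \<theta>"
    and \<phi>: "is_fm (star_lang L) \<phi>" "free_vars \<phi> \<subseteq> {..<n}"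
  shows "sat A e \<phi> = sat A e' \<phi>"
proof -
  obtain h where h: "partial_embedding (eval_tm A e ` meets n) h" "\<And>i. i < n \<Longrightarrow> h (e i) = e' i"
    "\<And>t. t \<in> meets n \<Longrightarrow> h (eval_tm A e t) = eval_tm A e' t"
    using atoms_agree_partial_embedding[OF e agree] by blast
  define S where "S = eval_tm A e ` meets n"
  have fS: "finite S" by (simp add: S_def meets_def)
  have S: "S \<noteq> {}" "S \<subseteq> U" "\<And>x y. x \<in> S \<Longrightarrow> y \<in> S \<Longrightarrow> x \<sqinter> y \<in> S"
    using h(1) n by (auto simp: S_def meets_def partial_embedding_def meet_closed_def)
  have hS: "h ` S \<subseteq> U" and hm: "\<And>x y. x \<in> S \<Longrightarrow> y \<in> S \<Longrightarrow> h (x \<sqinter> y) = h x \<sqinter> h y"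
    and hle: "\<And>x y. x \<in> S \<Longrightarrow> y \<in> S \<Longrightarrow> x \<sqsubseteq> y \<longleftrightarrow> h x \<sqsubseteq> h y"
    and hr: "\<And>R x ys. R \<in> rsyms L \<Longrightarrow> x \<in> S \<Longrightarrow> ys \<in> lists S \<Longrightarrow> length ys = rarity L R \<Longrightarrow>
      rint A (Star R) (x # ys) = rint A (Star R) (h x # map h ys)"
    using h(1)[folded S_def] by (simp_all add: partial_embedding_def)
  have hinj: "inj_on h S" using partial_embedding_inj h(1) by (simp add: S_def)
  have two: "length xs = 2 \<longleftrightarrow> (\<exists>x y. xs = [x, y])" for xs :: "'c list"
    by (auto simp: numeral_2_eq_2 length_Suc_conv)
  have st: "is_struct (star_lang L) (restrict_to A S')" if "S' \<noteq> {}" "\<And>x y. x \<in> S' \<Longrightarrow> y \<in> S' \<Longrightarrow> x \<sqinter> y \<in> S'" for S'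
    using that by (auto simp: is_struct_def restrict_to_def two)
  have fg: "finitely_generated (star_lang L) (restrict_to A S')" if "finite S'" for S'
    unfolding finitely_generated_def using that by (intro exI[of _ S']) (auto simp: restrict_to_def)
  have hcl: "x \<sqinter> y \<in> h ` S" if "x \<in> h ` S" "y \<in> h ` S" for x y
    using that S(3) hm by (metis (no_types, lifting) imageE imageI)
  have "isomorphism (star_lang L) (restrict_to A S) (restrict_to A (h ` S)) h"
    unfolding isomorphism_def embedding_def
  proof (intro conjI ballI impI)
    fix R xs assume R: "R \<in> rsyms (star_lang L)" "xs \<in> lists (univ (restrict_to A S))"
      "length xs = rarity (star_lang L) R"
    show "rint (restrict_to A S) R xs = rint (restrict_to A (h ` S)) R (map h xs)"
    proof (cases R)
      case Leq
      then show ?thesis using R hle by (auto simp: two restrict_to_def)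
    next
      case (Star R')
      then obtain x ys where "xs = x # ys" "length ys = rarity L R'"
        using R by (auto simp: length_Suc_conv)
      then show ?thesis using R hr Star by (auto simp: restrict_to_def)
    qed
  qed (use hinj hm in \<open>auto simp: two restrict_to_def\<close>)
  then obtain g where g: "isomorphism (star_lang L) A A g" "\<And>x. x \<in> S \<Longrightarrow> g x = h x"
    using S hS fS st[of S] st[of "h ` S"] fg[of S] fg[of "h ` S"] hcl
    using hom unfolding ultrahomogeneous_def by (metis finite_imageI image_is_empty)
  have eS: "e i \<in> S" if "i < n" for i
  proof -
    have "eval_tm A e (meet_tm (Var i) (Var i)) \<in> S"
      unfolding S_def by (rule imageI) (use that in \<open>auto simp: meets_def\<close>)
    then show ?thesis using e that by (simp add: meet_absorb)
  qed
  have "sat A (\<lambda>i. g (e i)) \<phi> = sat A e \<phi>"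
  proof (rule embedding_sat[OF _ struct \<phi>(1)])
    show "embedding (star_lang L) A A g" "quantifier_free \<phi> \<or> g ` U = U"
      using g by (auto simp: isomorphism_def)
    show "e ` free_vars \<phi> \<subseteq> U" using e \<phi> by auto
  qed
  moreover have "sat A (\<lambda>i. g (e i)) \<phi> = sat A e' \<phi>"
    by (rule sat_cong) (use \<phi> h(2) g(2) eS in auto)
  ultimately show ?thesis by simp
qed

text \<open>
  Quantifier elimination, stated without exhibiting a quantifier-free equivalent.
\<close>

locale treelike_limit_model = treelike_struct +
  assumes atoms_determine:
    "\<And>n e e' \<phi>. 0 < n \<Longrightarrow> (\<And>i. i < n \<Longrightarrow> e i \<in> U) \<Longrightarrow> (\<And>i. i < n \<Longrightarrow> e' i \<in> U) \<Longrightarrow>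
      (\<And>\<theta>. \<theta> \<in> atoms L n \<Longrightarrow> sat A e \<theta> = sat A e' \<theta>) \<Longrightarrow>
      is_fm (star_lang L) \<phi> \<Longrightarrow> free_vars \<phi> \<subseteq> {..<n} \<Longrightarrow> sat A e \<phi> = sat A e' \<phi>"

text \<open>
  Let \<open>\<chi>\<close> be the conjunction of the formulas in \<open>atoms L n\<close> and negations of such formulas that hold of
  a given tuple. In the limit \<open>N\<close> all realizations of \<open>\<chi>\<close> agree on \<open>\<phi>\<close>, so one of the sentences
  \<open>\<forall>x. \<chi> \<longrightarrow> \<phi>\<close> and \<open>\<forall>x. \<chi> \<longrightarrow> \<not> \<phi>\<close> holds in \<open>N\<close>, and therefore in every model of its theory.
\<close>

lemma models_limit_theory:
  fixes C :: "(tree_fun, 'r star_rel, 'a) struct"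
  assumes N: "fraisse_limit (star_lang L) (finite_models (star_lang L) (star_theory L T)) N"
    and fin: "finite (rsyms L)"
    and C: "is_struct (star_lang L) C" "models C (theory_of (star_lang L) N)"
  shows "treelike_limit_model L C"
proof -
  interpret N: treelike_struct L N using limit_is_treelike[OF N] .
  have hom: "ultrahomogeneous (star_lang L) N" using N by (simp add: fraisse_limit_def)
  have ne: "univ C \<noteq> {}" using C by (auto simp: is_struct_def)
  have transfer: "sat C e \<psi>"
    if \<psi>: "is_fm (star_lang L) \<psi>" "free_vars \<psi> \<subseteq> {..<n}"
      and N: "\<And>e. e ` {..<n} \<subseteq> univ N \<Longrightarrow> sat N e \<psi>" and e: "e ` {..<n} \<subseteq> univ C" for n \<psi> e
  proof -
    have "models N {Alls n \<psi>}" using N by (auto simp: models_Alls[OF N.nonempty \<psi>(2)])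
    then have "Alls n \<psi> \<in> theory_of (star_lang L) N" using \<psi> by (auto simp: theory_of_def)
    then have "models C {Alls n \<psi>}" using C by (auto simp: models_def)
    then show ?thesis using e by (auto simp: models_Alls[OF ne \<psi>(2)])
  qed
  have "models C (star_theory L {})"
    unfolding models_def
  proof (intro ballI allI impI)
    fix \<sigma> and e :: "nat \<Rightarrow> _" assume \<sigma>: "\<sigma> \<in> star_theory L {}" and e: "range e \<subseteq> univ C"
    then obtain n \<psi> where \<psi>: "\<sigma> = Alls n \<psi>" "quantifier_free \<psi>" "is_fm (star_lang L) \<psi>"
      "free_vars \<psi> \<subseteq> {..<n}" using star_theory_universal by blast
    have "models N {\<sigma>}" using N.star_models \<sigma> by (auto simp: models_def)
    then have "\<sigma> \<in> theory_of (star_lang L) N" using \<psi> by (auto simp: theory_of_def)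
    then show "sat C e \<sigma>" using C e by (auto simp: models_def)
  qed
  then interpret treelike_struct L C using C by unfold_locales auto
  show ?thesis
  proof
    fix n \<phi> and e e' :: "nat \<Rightarrow> 'a"
    assume n: "0 < n" and e: "\<And>i. i < n \<Longrightarrow> e i \<in> univ C" "\<And>i. i < n \<Longrightarrow> e' i \<in> univ C"
      and agree: "\<And>\<theta>. \<theta> \<in> atoms L n \<Longrightarrow> sat C e \<theta> = sat C e' \<theta>"
      and \<phi>: "is_fm (star_lang L) \<phi>" "free_vars \<phi> \<subseteq> {..<n}"
    obtain \<theta>s where \<theta>s: "set \<theta>s = atoms L n" using finite_list[OF finite_atoms[OF fin]] by blast
    define \<chi> where "\<chi> = Conjs (map (\<lambda>\<theta>. if sat C e \<theta> then \<theta> else Neg \<theta>) \<theta>s)"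
    have \<chi>_fm: "is_fm (star_lang L) \<chi>" "free_vars \<chi> \<subseteq> {..<n}"
      using is_fm_atoms free_vars_atoms \<theta>s by (fastforce simp: \<chi>_def)+
    have \<chi>: "sat C e \<chi>" "sat C e' \<chi>" using agree \<theta>s by (auto simp: \<chi>_def)
    have "(\<forall>d. d ` {..<n} \<subseteq> univ N \<longrightarrow> sat N d (Imp \<chi> \<phi>)) \<or>
      (\<forall>d. d ` {..<n} \<subseteq> univ N \<longrightarrow> sat N d (Imp \<chi> (Neg \<phi>)))"
    proof (rule ccontr)
      assume "\<not> ?thesis"
      then obtain d d' where d: "d ` {..<n} \<subseteq> univ N" "d' ` {..<n} \<subseteq> univ N"
        "sat N d \<chi>" "sat N d' \<chi>" "\<not> sat N d \<phi>" "sat N d' \<phi>" by auto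
      have "sat N d \<theta> = sat N d' \<theta>" if "\<theta> \<in> atoms L n" for \<theta>
      proof -
        have "sat N d \<theta> \<longleftrightarrow> sat C e \<theta>" if "sat N d \<chi>" for d
        proof -
          have "sat N d (if sat C e \<theta> then \<theta> else Neg \<theta>)"
            using that \<open>\<theta> \<in> atoms L n\<close> \<theta>s unfolding \<chi>_def sat_Conjs set_map by blast
          then show ?thesis by (simp split: if_splits)
        qed
        then show ?thesis using d(3,4) by blast
      qed
      then have "sat N d \<phi> = sat N d' \<phi>"
        using d(1,2) by (intro N.ultrahomogeneous_atoms_determine[OF hom n _ _ _ \<phi>]) auto
      then show False using d by simp
    qed
    moreover have e'': "e ` {..<n} \<subseteq> univ C" "e' ` {..<n} \<subseteq> univ C" using e by auto
    moreover have "is_fm (star_lang L) (Imp \<chi> \<phi>)" "free_vars (Imp \<chi> \<phi>) \<subseteq> {..<n}"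
      "is_fm (star_lang L) (Imp \<chi> (Neg \<phi>))" "free_vars (Imp \<chi> (Neg \<phi>)) \<subseteq> {..<n}"
      using \<chi>_fm \<phi> by auto
    ultimately have "(sat C e (Imp \<chi> \<phi>) \<and> sat C e' (Imp \<chi> \<phi>)) \<or>
      (sat C e (Imp \<chi> (Neg \<phi>)) \<and> sat C e' (Imp \<chi> (Neg \<phi>)))"
      using transfer by meson
    then show "sat C e \<phi> = sat C e' \<phi>" using \<chi> by auto
  qed
qed

lemma elementary_extension_models_theory:
  assumes "elementary_substruct L M C" "models M (theory_of L N)"
  shows "models C (theory_of L N)"
  unfolding models_def
proof (intro ballI allI impI)
  fix \<sigma> and e :: "nat \<Rightarrow> _" assume \<sigma>: "\<sigma> \<in> theory_of L N" and "range e \<subseteq> univ C"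
  obtain a where a: "a \<in> univ M" using assms by (auto simp: elementary_substruct_def is_struct_def)
  have "sat M (\<lambda>_. a) \<sigma>" using assms(2) \<sigma> a by (auto simp: models_def)
  then have "sat C (\<lambda>_. a) \<sigma>"
    using assms(1) \<sigma> a by (auto simp: elementary_substruct_def theory_of_def)
  moreover have "sat C (\<lambda>_. a) \<sigma> = sat C e \<sigma>"
    using \<sigma> by (intro sat_cong) (auto simp: theory_of_def)
  ultimately show "sat C e \<sigma>" by simp
qed

context treelike_limit_model begin

text \<open>
  The form in which quantifier elimination is used: atomic formulas are preserved by definition, and
  the values of the terms in \<open>meets n\<close> stay in \<open>S\<close>, because \<open>S\<close> is closed under meets.
\<close>

lemma partial_embedding_sat:
  assumes h: "partial_embedding S h" and l: "set l \<subseteq> S"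
    and \<phi>: "is_fm (star_lang L) \<phi>" "free_vars \<phi> \<subseteq> {..<length l}"
  shows "sat A (nth l) \<phi> = sat A (nth (map h l)) \<phi>"
proof (cases "l = []")
  case False
  have S: "S \<subseteq> U" "\<And>x y. x \<in> S \<Longrightarrow> y \<in> S \<Longrightarrow> x \<sqinter> y \<in> S" "h ` S \<subseteq> U"
    and hm: "\<And>x y. x \<in> S \<Longrightarrow> y \<in> S \<Longrightarrow> h (x \<sqinter> y) = h x \<sqinter> h y"
    and hle: "\<And>x y. x \<in> S \<Longrightarrow> y \<in> S \<Longrightarrow> x \<sqsubseteq> y \<longleftrightarrow> h x \<sqsubseteq> h y"
    and hr: "\<And>R x ys. R \<in> rsyms L \<Longrightarrow> x \<in> S \<Longrightarrow> ys \<in> lists S \<Longrightarrow> length ys = rarity L R \<Longrightarrow>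
      rint A (Star R) (x # ys) = rint A (Star R) (h x # map h ys)"
    using h by (simp_all add: partial_embedding_def meet_closed_def)
  have hinj: "inj_on h S" using partial_embedding_inj h by simp
  have lS: "l ! i \<in> S" if "i < length l" for i using l that by (auto simp: subset_iff)
  have t: "eval_tm A (nth l) t \<in> S" "eval_tm A (nth (map h l)) t = h (eval_tm A (nth l) t)"
    if "t \<in> meets (length l)" for t
    using that lS S hm by (auto simp: meets_def)
  show ?thesis
  proof (rule atoms_determine[OF _ _ _ _ \<phi>])
    fix \<theta> assume "\<theta> \<in> atoms L (length l)"
    then consider s t u where "\<theta> = Eq (meet_tm s t) u" "s \<in> meets (length l)" "t \<in> meets (length l)"
        "u \<in> meets (length l)"
      | s t where "\<theta> = leq_fm s t" "s \<in> meets (length l)" "t \<in> meets (length l)"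
      | R t ts where "\<theta> = Rel (Star R) (t # ts)" "R \<in> rsyms L" "t \<in> meets (length l)"
        "set ts \<subseteq> meets (length l)" "length ts = rarity L R"
      by (auto simp: atoms_def length_Suc_conv)
    then show "sat A (nth l) \<theta> = sat A (nth (map h l)) \<theta>"
    proof cases
      case 1
      then show ?thesis using t S hm by (auto simp: inj_on_eq_iff[OF hinj] simp flip: hm)
    next
      case 2
      then show ?thesis using t hle by simp
    next
      case (3 R s ts)
      have "map (eval_tm A (nth (map h l))) ts = map h (map (eval_tm A (nth l)) ts)"
        using 3 t(2) by auto
      moreover have "map (eval_tm A (nth l)) ts \<in> lists S" using 3(4) t(1) by (auto simp: subset_iff)
      ultimately show ?thesis using hr[of R "eval_tm A (nth l) s" "map (eval_tm A (nth l)) ts"] 3 t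
        by (simp del: map_map)
    qed
  qed (use False lS S in auto)
next
  case True
  then show ?thesis by simp
qed

lemma agree_partial_embedding:
  assumes U: "set u \<subseteq> U" "set v \<subseteq> U" and len: "length u = length v"
    and agree: "\<And>\<phi>. is_fm (star_lang L) \<phi> \<Longrightarrow> free_vars \<phi> \<subseteq> {..<length u} \<Longrightarrow>
      sat A (nth u) \<phi> = sat A (nth v) \<phi>"
  obtains S h where "partial_embedding S h" "S = (\<lambda>(x, y). x \<sqinter> y) ` (set u \<times> set u)"
    "map h u = v"
proof -
  have U': "u ! i \<in> U" "v ! i \<in> U" if "i < length u" for i using U len that by (auto simp: subset_iff)
  obtain h where h: "partial_embedding (eval_tm A (nth u) ` meets (length u)) h"
    "\<And>i. i < length u \<Longrightarrow> h (u ! i) = v ! i"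
    using atoms_agree_partial_embedding[of "length u" "nth u" "nth v"] U' agree
      is_fm_atoms free_vars_atoms by metis
  have "eval_tm A (nth u) ` meets (length u) = (\<lambda>(x, y). x \<sqinter> y) ` (set u \<times> set u)"
    unfolding meets_def by (force simp: in_set_conv_nth image_iff)
  then show thesis using h len by (intro that[OF h(1)]) (auto intro: nth_equalityI)
qed

end

section \<open>Moving points of the chain below an element\<close>

context treelike_struct begin

lemma le_iff_meet: "x \<in> U \<Longrightarrow> y \<in> U \<Longrightarrow> x \<sqsubseteq> y \<longleftrightarrow> x \<sqinter> y = x"
  using meet_absorb meet_le by metis

lemma less_le_trans: "\<lbrakk>x \<sqsubset> y; y \<sqsubseteq> z; x \<in> U; y \<in> U; z \<in> U\<rbrakk> \<Longrightarrow> x \<sqsubset> z"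
  unfolding less_def by (metis le_antisym le_trans)

lemma le_less_trans: "\<lbrakk>x \<sqsubseteq> y; y \<sqsubset> z; x \<in> U; y \<in> U; z \<in> U\<rbrakk> \<Longrightarrow> x \<sqsubset> z"
  unfolding less_def by (metis le_antisym le_trans)

lemma not_less_self: "\<not> x \<sqsubset> x"
  by (simp add: less_def)

lemma less_not_le: "\<lbrakk>x \<sqsubset> y; x \<in> U; y \<in> U\<rbrakk> \<Longrightarrow> \<not> y \<sqsubseteq> x"
  unfolding less_def using le_antisym by blast

lemma not_le_iff_below: "\<lbrakk>x \<sqsubseteq> c; y \<sqsubseteq> c; x \<in> U; y \<in> U; c \<in> U\<rbrakk> \<Longrightarrow> \<not> x \<sqsubseteq> y \<longleftrightarrow> y \<sqsubset> x"
  unfolding less_def using le_linear_below le_antisym le_refl by metis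

lemma meet_below:
  assumes "a \<sqsubseteq> c" "t \<in> U" "a \<in> U" "c \<in> U"
  shows "t \<sqinter> a = t \<sqinter> c \<sqinter> a"
  using assms by (simp add: meet_assoc meet_absorb2)

lemma meet_leI1: "x \<sqsubseteq> z \<Longrightarrow> x \<in> U \<Longrightarrow> y \<in> U \<Longrightarrow> z \<in> U \<Longrightarrow> x \<sqinter> y \<sqsubseteq> z"
  using le_trans[OF meet_le(1)] by blast

lemma meet_leI2: "y \<sqsubseteq> z \<Longrightarrow> x \<in> U \<Longrightarrow> y \<in> U \<Longrightarrow> z \<in> U \<Longrightarrow> x \<sqinter> y \<sqsubseteq> z"
  using le_trans[OF meet_le(2)] by blast

text \<open>
  In a meet-semilattice an injective map that preserves meets also preserves and reflects the order.
  By (OC) the relations \<open>R\<^sup>*(x, ys)\<close> only have to be compared if \<open>x\<close> is below all of \<open>ys\<close>.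
\<close>

lemma partial_embeddingI:
  assumes "meet_closed S" "h ` S \<subseteq> U" "inj_on h S"
    and meet: "\<And>x y. x \<in> S \<Longrightarrow> y \<in> S \<Longrightarrow> h (x \<sqinter> y) = h x \<sqinter> h y"
    and rel: "\<And>R x ys. R \<in> rsyms L \<Longrightarrow> x \<in> S \<Longrightarrow> set ys \<subseteq> S \<Longrightarrow> length ys = rarity L R \<Longrightarrow>
      (\<And>y z. y \<in> S \<Longrightarrow> z \<in> S \<Longrightarrow> y \<sqsubset> z \<longleftrightarrow> h y \<sqsubset> h z) \<Longrightarrow>
      \<forall>y\<in>set ys. x \<sqsubset> y \<Longrightarrow>
      rint A (Star R) (x # ys) = rint A (Star R) (h x # map h ys)"
  shows "partial_embedding S h"
proof -
  have U: "x \<in> U" "h x \<in> U" if "x \<in> S" for x using assms that by (auto simp: meet_closed_def)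
  have le: "x \<sqsubseteq> y \<longleftrightarrow> h x \<sqsubseteq> h y" if "x \<in> S" "y \<in> S" for x y
    using that U assms(1) inj_on_eq_iff[OF assms(3), of "x \<sqinter> y" x] meet[OF that]
    by (simp add: le_iff_meet meet_closed_def)
  have less: "x \<sqsubset> y \<longleftrightarrow> h x \<sqsubset> h y" if "x \<in> S" "y \<in> S" for x y
    unfolding less_def using le[OF that] inj_on_eq_iff[OF assms(3) that] by simp
  have "rint A (Star R) (x # ys) = rint A (Star R) (h x # map h ys)"
    if R: "R \<in> rsyms L" "x \<in> S" "ys \<in> lists S" "length ys = rarity L R" for R x ys
  proof (cases "\<forall>y\<in>set ys. x \<sqsubset> y")
    case True
    moreover have "set ys \<subseteq> S" using R by auto
    ultimately show ?thesis using rel[OF R(1,2) _ R(4) less] by blast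
  next
    case False
    then obtain y where y: "y \<in> set ys" "\<not> x \<sqsubset> y" by blast
    then have "\<not> rint A (Star R) (x # ys)"
      using open_cone[of R ys x y] R(1,3,4) U[OF R(2)] U by blast
    moreover have "\<not> rint A (Star R) (h x # map h ys)"
    proof -
      have "set (map h ys) \<subseteq> U" using R U by auto
      moreover have "\<not> h x \<sqsubset> h y" using less[of x y] R(2,3) y by auto
      ultimately show ?thesis
        using open_cone[of R "map h ys" "h x" "h y"] R(1,4) U(2)[OF R(2)] y(1) by auto
    qed
    ultimately show ?thesis by simp
  qed
  then show ?thesis using assms le by (simp add: partial_embedding_def)
qed

text \<open>
  The relation in (WD), to lie in the same open cone above \<open>x\<close>, is symmetric.
\<close>

lemma star_cong:
  assumes R: "R \<in> rsyms L" "length ys = rarity L R"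
    and xy: "list_all2 (\<lambda>y y'. x \<sqsubset> y \<sqinter> y') ys ys'"
    and U: "x \<in> U" "set ys \<subseteq> U" "set ys' \<subseteq> U"
  shows "rint A (Star R) (x # ys) \<longleftrightarrow> rint A (Star R) (x # ys')"
proof
  assume "rint A (Star R) (x # ys)"
  then show "rint A (Star R) (x # ys')" using well_defined[of R ys x ys'] assms by blast
next
  assume "rint A (Star R) (x # ys')"
  moreover have "list_all2 (\<lambda>y y'. x \<sqsubset> y \<sqinter> y') ys' ys"
    unfolding list_all2_conv_all_nth
  proof (intro conjI allI impI)
    show len: "length ys' = length ys" by (rule list_all2_lengthD[OF xy, symmetric])
    fix i assume i: "i < length ys'"
    then have "ys ! i \<in> U" "ys' ! i \<in> U" using U len by auto
    then show "x \<sqsubset> ys' ! i \<sqinter> ys ! i"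
      using meet_commute[of "ys ! i" "ys' ! i"] list_all2_nthD2[OF xy i] by simp
  qed
  ultimately show "rint A (Star R) (x # ys)"
    using well_defined[of R ys' x ys] assms list_all2_lengthD[OF xy] by simp
qed

lemma chain_meet_cases:
  assumes "a \<sqsubseteq> c" "b \<sqsubseteq> c" "a \<in> U" "b \<in> U" "c \<in> U"
  shows "a \<sqinter> b = a \<or> a \<sqinter> b = b"
  using le_linear_below[OF assms(1,2)] assms meet_absorb meet_absorb2 by metis

text \<open>
  Projecting to the chain below \<open>c\<close> turns meets into minima.
\<close>

lemma meet_meet_below:
  assumes "t \<in> U" "s \<in> U" "c \<in> U"
  shows "t \<sqinter> s \<sqinter> c = t \<sqinter> c \<or> t \<sqinter> s \<sqinter> c = s \<sqinter> c"
proof -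
  have "t \<sqinter> s \<sqinter> c = (t \<sqinter> c) \<sqinter> (s \<sqinter> c)"
    using assms by (intro le_antisym) (simp_all add: le_meet_iff meet_leI1 meet_leI2)
  moreover have "t \<sqinter> c \<sqsubseteq> c" "s \<sqinter> c \<sqsubseteq> c" using assms by (simp_all add: meet_le)
  ultimately show ?thesis using chain_meet_cases[of "t \<sqinter> c" c "s \<sqinter> c"] assms by auto
qed

text \<open>
  The points of \<open>X\<close> are moved by \<open>f\<close>, while the other elements follow a given partial embedding \<open>g\<close>
  that fixes \<open>c\<close>. An element \<open>t\<close> is kept in the domain if its projection \<open>t \<sqinter> c\<close> hits no \<open>x \<in> X\<close>,
  and if \<open>g t \<sqinter> c\<close> is on the same side of \<open>f x\<close>. Then \<open>t \<sqinter> x\<close> is either \<open>t \<sqinter> c\<close> or \<open>x\<close>, and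
  correspondingly for the images, which takes care of meets. A relation \<open>R\<^sup>*(t, \<dots>)\<close> with \<open>t \<notin> X\<close> does not
  change when its arguments from \<open>X\<close> are replaced by \<open>c\<close>, since they are in the cone of \<open>c\<close> above \<open>t\<close>;
  a relation \<open>R\<^sup>*(x, \<dots>)\<close> with \<open>x \<in> X\<close> does not change when all its arguments are replaced by \<open>c\<close>, and
  becomes part of the colour of \<open>x\<close>.
\<close>

lemma partial_embedding_move:
  assumes g: "partial_embedding S\<^sub>0 g" and c: "c \<in> S\<^sub>0" "g c = c"
    and X: "X \<subseteq> U" "\<And>x. x \<in> X \<Longrightarrow> x \<sqsubset> c"
    and f: "f ` X \<subseteq> U" "\<And>x. x \<in> X \<Longrightarrow> f x \<sqsubset> c"
      "\<And>x y. x \<in> X \<Longrightarrow> y \<in> X \<Longrightarrow> x \<sqsubseteq> y \<longleftrightarrow> f x \<sqsubseteq> f y"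
    and colour: "\<And>R x. R \<in> rsyms L \<Longrightarrow> x \<in> X \<Longrightarrow>
      rint A (Star R) (x # replicate (rarity L R) c) = rint A (Star R) (f x # replicate (rarity L R) c)"
  defines "S \<equiv> {t \<in> S\<^sub>0. \<forall>x\<in>X. (t \<sqinter> c \<sqsubset> x \<and> g t \<sqinter> c \<sqsubset> f x) \<or> (x \<sqsubset> t \<sqinter> c \<and> f x \<sqsubset> g t \<sqinter> c)}"
  shows "partial_embedding (S \<union> X) (\<lambda>t. if t \<in> X then f t else g t)"
proof -
  define h where "h t = (if t \<in> X then f t else g t)" for t
  have S0: "t \<in> U" "g t \<in> U" if "t \<in> S\<^sub>0" for t
    using g that by (auto simp: partial_embedding_def meet_closed_def)
  have S0_meet: "t \<sqinter> s \<in> S\<^sub>0" "g (t \<sqinter> s) = g t \<sqinter> g s" if "t \<in> S\<^sub>0" "s \<in> S\<^sub>0" for t s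
    using g that by (auto simp: partial_embedding_def meet_closed_def)
  have cU: "c \<in> U" using S0 c by blast
  have SS0: "S \<subseteq> S\<^sub>0" by (auto simp: S_def)
  have SU: "t \<in> U" "g t \<in> U" if "t \<in> S" for t using S0 SS0 that by auto
  have XU: "x \<in> U" "f x \<in> U" "x \<sqsubseteq> c" "f x \<sqsubseteq> c" if "x \<in> X" for x
    using X f that by (auto simp: less_def)
  have sep: "(t \<sqinter> c \<sqsubset> x \<and> g t \<sqinter> c \<sqsubset> f x) \<or> (x \<sqsubset> t \<sqinter> c \<and> f x \<sqsubset> g t \<sqinter> c)" if "t \<in> S" "x \<in> X" for t x
    using that by (auto simp: S_def)
  have disj: "t \<notin> X" if "t \<in> S" for t
    using sep[OF that, of t] XU[of t] by (auto simp: meet_absorb cU not_less_self)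
  have hS: "h t = g t" if "t \<in> S" for t using disj that by (simp add: h_def)
  have hX: "h x = f x" if "x \<in> X" for x using that by (simp add: h_def)
  have cS: "c \<in> S" using c X f cU by (auto simp: S_def meet_absorb)
  have S_meet: "t \<sqinter> s \<in> S" if ts: "t \<in> S" "s \<in> S" for t s
  proof -
    have "(t \<sqinter> s \<sqinter> c \<sqsubset> x \<and> g (t \<sqinter> s) \<sqinter> c \<sqsubset> f x) \<or> (x \<sqsubset> t \<sqinter> s \<sqinter> c \<and> f x \<sqsubset> g (t \<sqinter> s) \<sqinter> c)"
      if x: "x \<in> X" for x
    proof -
      have *: "t' \<sqinter> s' \<sqinter> c \<sqsubset> z"
        if "t' \<sqinter> c \<sqsubset> z \<or> s' \<sqinter> c \<sqsubset> z" "t' \<in> U" "s' \<in> U" "z \<in> U" for t' s' z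
      proof -
        have "t' \<sqinter> s' \<sqinter> c \<sqsubseteq> t' \<sqinter> c" "t' \<sqinter> s' \<sqinter> c \<sqsubseteq> s' \<sqinter> c"
          using that cU by (simp_all add: le_meet_iff meet_leI1 meet_leI2)
        moreover have "t' \<sqinter> s' \<sqinter> c \<in> U" "t' \<sqinter> c \<in> U" "s' \<sqinter> c \<in> U" using that cU by auto
        ultimately show ?thesis using that(1,4) le_less_trans by blast
      qed
      have **: "z \<sqsubset> t' \<sqinter> s' \<sqinter> c" if "z \<sqsubset> t' \<sqinter> c" "z \<sqsubset> s' \<sqinter> c" "t' \<in> U" "s' \<in> U" for t' s' z
        using meet_meet_below[of t' s' c] that cU by auto
      have gts: "g (t \<sqinter> s) = g t \<sqinter> g s" using S0_meet(2) ts SS0 by blast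
      show ?thesis
        using sep[OF ts(1) x] sep[OF ts(2) x] *[of t x s] *[of "g t" "f x" "g s"]
          **[of x t s] **[of "f x" "g t" "g s"] SU[OF ts(1)] SU[OF ts(2)] XU(1)[OF x] XU(2)[OF x]
        unfolding gts by blast
    qed
    then show ?thesis using S0_meet ts SS0 by (auto simp: S_def)
  qed
  have key: "t \<sqinter> c \<sqsubset> x \<Longrightarrow> t \<sqinter> x = t \<sqinter> c" "x \<sqsubset> t \<sqinter> c \<Longrightarrow> t \<sqinter> x = x"
    if "t \<in> U" "x \<in> U" "x \<sqsubseteq> c" for t x
    using that cU meet_below[of x c t] by (auto simp: less_def meet_absorb meet_absorb2)
  have meet_SX: "t \<sqinter> x \<in> S \<union> X \<and> h (t \<sqinter> x) = h t \<sqinter> h x" if "t \<in> S" "x \<in> X" for t x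
  proof -
    have "t \<sqinter> c \<in> S" "g (t \<sqinter> c) = g t \<sqinter> c"
      using S_meet[OF that(1) cS] S0_meet that c SS0 by auto
    moreover have "t \<sqinter> x = t \<sqinter> c \<and> g t \<sqinter> f x = g t \<sqinter> c \<or> t \<sqinter> x = x \<and> g t \<sqinter> f x = f x"
      using sep[OF that] key(1)[OF SU(1)[OF that(1)] XU(1)[OF that(2)] XU(3)[OF that(2)]]
        key(1)[OF SU(2)[OF that(1)] XU(2)[OF that(2)] XU(4)[OF that(2)]]
        key(2)[OF SU(1)[OF that(1)] XU(1)[OF that(2)] XU(3)[OF that(2)]]
        key(2)[OF SU(2)[OF that(1)] XU(2)[OF that(2)] XU(4)[OF that(2)]] by blast
    ultimately show ?thesis using hS[OF that(1)] hX[OF that(2)] hS[of "t \<sqinter> c"] that(2) by auto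
  qed
  have meet_XX: "x \<sqinter> y \<in> X \<and> h (x \<sqinter> y) = h x \<sqinter> h y" if "x \<in> X" "y \<in> X" for x y
  proof -
    have "x \<sqsubseteq> y \<or> y \<sqsubseteq> x"
      using le_linear_below[of x c y] XU(1)[OF that(1)] XU(3)[OF that(1)] XU(1)[OF that(2)] XU(3)[OF that(2)] cU by blast
    then show ?thesis
    proof
      assume "x \<sqsubseteq> y"
      then show ?thesis
        using f(3)[OF that] that XU(1,2)[OF that(1)] XU(1,2)[OF that(2)] hX by (simp add: meet_absorb)
    next
      assume "y \<sqsubseteq> x"
      then show ?thesis
        using f(3)[OF that(2,1)] that XU(1,2)[OF that(1)] XU(1,2)[OF that(2)] hX by (simp add: meet_absorb2)
    qed
  qed
  have hU: "h t \<in> U" "t \<in> U" if "t \<in> S \<union> X" for t using that SU XU hS hX by auto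
  have meet: "t \<sqinter> s \<in> S \<union> X" "h (t \<sqinter> s) = h t \<sqinter> h s" if ts: "t \<in> S \<union> X" "s \<in> S \<union> X" for t s
  proof -
    consider "t \<in> S" "s \<in> S" | "t \<in> S" "s \<in> X" | "t \<in> X" "s \<in> S" | "t \<in> X" "s \<in> X" using ts by blast
    then have "t \<sqinter> s \<in> S \<union> X \<and> h (t \<sqinter> s) = h t \<sqinter> h s"
    proof cases
      case 1
      then show ?thesis using S_meet[of t s] S0_meet[of t s] hS SS0 by auto
    next
      case 3
      then show ?thesis
        using meet_SX[of s t] hU[of t] hU[of s] meet_commute[of t s] meet_commute[of "h t" "h s"] by auto
    qed (use meet_SX meet_XX in auto)
    then show "t \<sqinter> s \<in> S \<union> X" "h (t \<sqinter> s) = h t \<sqinter> h s" by auto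
  qed
  have cross: "g t \<noteq> f x" if "t \<in> S" "x \<in> X" for t x
    using sep[OF that] XU[OF that(2)] cU by (auto simp: meet_absorb not_less_self)
  have inj: "inj_on h (S \<union> X)"
  proof (rule inj_onI)
    fix t s assume ts: "t \<in> S \<union> X" "s \<in> S \<union> X" "h t = h s"
    have "x = y" if "x \<in> S" "y \<in> S" "g x = g y" for x y
      using inj_onD[OF partial_embedding_inj[OF g] that(3)] that SS0 by blast
    moreover have "x = y" if "x \<in> X" "y \<in> X" "f x = f y" for x y
      using f(3)[of x y] f(3)[of y x] that XU(1)[of x] XU(2)[of x] XU(1)[of y] XU(2)[of y] le_antisym[of x y] le_refl[of "f y"]
      by auto
    ultimately show "t = s" using ts cross[of t s] cross[of s t] by (metis UnE hS hX)
  qed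
  have "partial_embedding (S \<union> X) h"
  proof (rule partial_embeddingI[OF _ _ inj meet(2)])
    show "meet_closed (S \<union> X)" "h ` (S \<union> X) \<subseteq> U" using hU meet by (auto simp: meet_closed_def)
    fix R x ys
    assume R: "R \<in> rsyms L" "length ys = rarity L R" and x: "x \<in> S \<union> X" and ys: "set ys \<subseteq> S \<union> X"
      and less: "\<And>y z. y \<in> S \<union> X \<Longrightarrow> z \<in> S \<union> X \<Longrightarrow> y \<sqsubset> z \<longleftrightarrow> h y \<sqsubset> h z" and xy: "\<forall>y\<in>set ys. x \<sqsubset> y"
    have hxy: "h x \<sqsubset> h y" if "y \<in> set ys" for y using less[of x y] x ys xy that by auto
    have xU: "x \<in> U" "h x \<in> U" and ysU: "set ys \<subseteq> U" "set (map h ys) \<subseteq> U"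
      using hU x ys by (auto simp: subset_iff)
    show "rint A (Star R) (x # ys) = rint A (Star R) (h x # map h ys)"
    proof (cases "x \<in> X")
      case False
      then have xS: "x \<in> S" using x by blast
      \<comment> \<open>Replacing the points of \<open>X\<close> above \<open>x\<close> by \<open>c\<close> reduces the claim to the embedding \<open>g\<close>.\<close>
      define k where "k y = (if y \<in> X then c else y)" for y
      have kS: "k y \<in> S" "y \<sqinter> k y = y" "h y \<sqinter> g (k y) = h y" if "y \<in> S \<union> X" for y
        using that cS c cU hU XU SU by (auto simp: k_def meet_absorb hX hS)
      have "rint A (Star R) (x # ys) = rint A (Star R) (x # map k ys)"
        using R xy xU ysU kS SU ys by (intro star_cong) (auto simp: list.rel_map subset_iff intro!: list_all2_refl list.rel_refl_strong)
      also have "\<dots> = rint A (Star R) (g x # map g (map k ys))"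
      proof -
        have "map k ys \<in> lists S\<^sub>0" using kS ys SS0 by (auto simp: subset_iff)
        then show ?thesis using g R xS SS0 unfolding partial_embedding_def by (metis length_map subsetD)
      qed
      also have "\<dots> = rint A (Star R) (h x # map h ys)"
        unfolding hS[OF xS, symmetric]
        using R hxy xU ysU kS SU ys
        by (intro star_cong[symmetric]) (auto simp: list.rel_map subset_iff intro!: list_all2_refl list.rel_refl_strong)
      finally show ?thesis .
    next
      case True
      have 1: "x \<sqsubset> y \<sqinter> c" "h x \<sqsubset> h y \<sqinter> c" if "y \<in> set ys" for y
      proof -
        have y: "y \<in> S \<union> X" "x \<sqsubset> y" "h x \<sqsubset> h y" using that ys xy hxy by auto
        have "x \<sqsubset> y \<sqinter> c \<and> h x \<sqsubset> h y \<sqinter> c"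
        proof (cases "y \<in> X")
          case yX: True
          then show ?thesis using y XU cU hX by (auto simp: meet_absorb)
        next
          case False
          then have yS: "y \<in> S" using y by blast
          have "x \<sqsubseteq> y \<sqinter> c" using y True XU SU[OF yS] cU by (auto simp: le_meet_iff less_def)
          then show ?thesis using sep[OF yS True] less_not_le[of "y \<sqinter> c" x] SU[OF yS] XU[OF True] cU hS[OF yS] hX[OF True]
            by auto
        qed
        then show "x \<sqsubset> y \<sqinter> c" "h x \<sqsubset> h y \<sqinter> c" by auto
      qed
      have "rint A (Star R) (x # ys) = rint A (Star R) (x # replicate (rarity L R) c)"
        using R xU ysU cU 1 by (intro star_cong) (auto simp: list_all2_conv_all_nth)
      also have "\<dots> = rint A (Star R) (h x # replicate (rarity L R) c)"
        using colour R True hX by auto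
      also have "\<dots> = rint A (Star R) (h x # map h ys)"
        using R xU ysU cU 1 by (intro star_cong[symmetric]) (auto simp: list_all2_conv_all_nth)
      finally show ?thesis .
    qed
  qed
  then show ?thesis by (simp add: h_def[abs_def])
qed

end

section \<open>Adding a point of the chain to the parameters\<close>

lemma length_concat_tuples:
  "(\<And>i. i \<in> set is \<Longrightarrow> length (a i) = m) \<Longrightarrow> length (concat (map a is)) = length is * m"
  by (induction "is") auto

lemma indiscernibleD:
  assumes "indiscernible L C P m I a"
  shows "i \<in> I \<Longrightarrow> length (a i) = m" "i \<in> I \<Longrightarrow> set (a i) \<subseteq> univ C"
    "\<lbrakk>set is \<subseteq> I; set js \<subseteq> I; sorted_wrt (<) is; sorted_wrt (<) js; length is = length js;
      is_fm L \<phi>; set bs \<subseteq> P; free_vars \<phi> \<subseteq> {..<length is * m + length bs}\<rbrakk> \<Longrightarrow>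
      sat C (nth (concat (map a is) @ bs)) \<phi> = sat C (nth (concat (map a js) @ bs)) \<phi>"
  using assms unfolding indiscernible_def par_fms_def by blast+

lemma indiscernibleI:
  assumes "\<And>i. i \<in> I \<Longrightarrow> length (a i) = m" "\<And>i. i \<in> I \<Longrightarrow> set (a i) \<subseteq> univ C"
    "\<And>is js \<phi> bs. \<lbrakk>set is \<subseteq> I; set js \<subseteq> I; sorted_wrt (<) is; sorted_wrt (<) js; length is = length js;
      is_fm L \<phi>; set bs \<subseteq> P; free_vars \<phi> \<subseteq> {..<length is * m + length bs}\<rbrakk> \<Longrightarrow>
      sat C (nth (concat (map a is) @ bs)) \<phi> = sat C (nth (concat (map a js) @ bs)) \<phi>"
  shows "indiscernible L C P m I a"
  using assms unfolding indiscernible_def par_fms_def by blast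

lemma indiscernible_mono:
  assumes "indiscernible L C P m I a" "P' \<subseteq> P" "I' \<subseteq> I"
  shows "indiscernible L C P' m I' a"
  using assms(2,3) indiscernibleD[OF assms(1)]
  by (intro indiscernibleI) (blast | rule indiscernibleD(3)[OF assms(1)], auto)+

context treelike_limit_model begin

text \<open>
  By indiscernibility there is a partial embedding \<open>g\<close> that takes one subsequence to the other and fixes the
  given parameters other than \<open>b\<close>. If \<open>b\<close> is the projection of an element of the subsequence or of a
  parameter, then it is in the domain of \<open>g\<close> and the hypothesis on positions gives \<open>g b = b\<close>.
  Otherwise \<open>g\<close> can be extended by \<open>b \<mapsto> b\<close>.
\<close>

lemma indiscernible_insert_below:
  assumes ind: "indiscernible (star_lang L) A P m I a"
    and P: "P \<subseteq> U" "c \<in> P" and b: "b \<in> U" "b \<sqsubset> c"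
    and pos: "\<And>i j s. i \<in> I \<Longrightarrow> j \<in> I \<Longrightarrow> s < m \<Longrightarrow>
      (a i ! s \<sqinter> c \<sqsubseteq> b \<longleftrightarrow> a j ! s \<sqinter> c \<sqsubseteq> b) \<and> (b \<sqsubseteq> a i ! s \<sqinter> c \<longleftrightarrow> b \<sqsubseteq> a j ! s \<sqinter> c)"
  shows "indiscernible (star_lang L) A (insert b P) m I a"
proof (rule indiscernibleI)
  fix "is" js \<phi> bs
  assume "is": "set is \<subseteq> I" "set js \<subseteq> I" "sorted_wrt (<) is" "sorted_wrt (<) js" "length is = length js"
    and \<phi>: "is_fm (star_lang L) \<phi>" "set bs \<subseteq> insert b P" "free_vars \<phi> \<subseteq> {..<length is * m + length bs}"
  note ind' = indiscernibleD[OF ind]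
  define u where "u = concat (map a is)"
  define v where "v = concat (map a js)"
  define ps where "ps = filter (\<lambda>x. x \<noteq> b) bs @ [c]"
  have ps: "set ps \<subseteq> P" "c \<in> set ps" using \<phi>(2) P by (auto simp: ps_def)
  have len: "length u = length is * m" "length v = length is * m"
    using length_concat_tuples[of "is" a m] length_concat_tuples[of js a m] "is" ind'(1)
    by (auto simp: u_def v_def)
  have uv: "set u \<subseteq> U" "set v \<subseteq> U"
    unfolding u_def v_def using "is" ind'(2) by fastforce+
  have agree: "sat A (nth (u @ ps)) \<psi> = sat A (nth (v @ ps)) \<psi>"
    if "is_fm (star_lang L) \<psi>" "free_vars \<psi> \<subseteq> {..<length (u @ ps)}" for \<psi>
    unfolding u_def v_def using that "is" ps len by (intro ind'(3)) auto
  have "set (u @ ps) \<subseteq> U" "set (v @ ps) \<subseteq> U" "length (u @ ps) = length (v @ ps)"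
    using uv ps P len by auto
  from agree_partial_embedding[OF this agree] obtain S g where g: "partial_embedding S g"
    and S: "S = (\<lambda>(x, y). x \<sqinter> y) ` (set (u @ ps) \<times> set (u @ ps))" and "map g (u @ ps) = v @ ps"
    by blast
  then have gu: "map g u = v" and gps: "map g ps = ps" using len by auto
  have g_id: "g x = x" if "x \<in> set ps" for x using gps that by (metis in_set_conv_nth nth_map)
  then have gc: "g c = c" using ps by blast
  have cU: "c \<in> U" "b \<sqsubseteq> c" using P b by (auto simp: less_def)
  define Q where "Q x y \<longleftrightarrow> (x \<sqinter> c \<sqsubseteq> b \<longleftrightarrow> y \<sqinter> c \<sqsubseteq> b) \<and> (b \<sqsubseteq> x \<sqinter> c \<longleftrightarrow> b \<sqsubseteq> y \<sqinter> c)" for x y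
  have "list_all2 (list_all2 Q) (map a is) (map a js)"
    using "is" ind'(1) pos by (auto simp: list_all2_conv_all_nth Q_def subset_iff)
  then have "list_all2 Q u v"
    unfolding u_def v_def using concat_transfer[of Q] by (auto simp: rel_fun_def)
  then have "\<forall>x\<in>set u. Q x (g x)" unfolding gu[symmetric] by (simp add: list.rel_map list_all2_same)
  moreover have "\<forall>x\<in>set ps. Q x (g x)" using g_id by (simp add: Q_def)
  ultimately have Q: "Q x (g x)" if "x \<in> set u \<union> set ps" for x using that by blast
  have upU: "x \<in> U" "g x \<in> U" if "x \<in> set u \<union> set ps" for x
    using that uv ps P g_id gu by auto
  have upS: "x \<sqinter> c \<in> S" "x \<in> S" if "x \<in> set u \<union> set ps" for x
  proof -
    have "(x, c) \<in> set (u @ ps) \<times> set (u @ ps)" "(x, x) \<in> set (u @ ps) \<times> set (u @ ps)"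
      using that ps by auto
    then show "x \<sqinter> c \<in> S" "x \<in> S" using upU[OF that] unfolding S by (force simp: meet_absorb)+
  qed
  have bs: "x \<in> set ps" if "x \<in> set bs" "x \<noteq> b" for x using that by (simp add: ps_def)
  have cS: "c \<in> S" using upS ps by blast
  \<comment> \<open>Either \<open>b\<close> is a projection, and \<open>g\<close> fixes it already, or it can be added to the domain.\<close>
  have "\<exists>S h. partial_embedding S h \<and> set (u @ bs) \<subseteq> S \<and> map h (u @ bs) = v @ bs"
  proof (cases "\<exists>x\<in>set u \<union> set ps. x \<sqinter> c = b")
    case True
    then obtain x where x: "x \<in> set u \<union> set ps" "x \<sqinter> c = b" by blast
    have "g b = g x \<sqinter> c"
      using g upS[OF x(1)] cS gc x(2) unfolding partial_embedding_def by metis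
    moreover have "g x \<sqinter> c = b"
      using Q[OF x(1)] x(2) b upU[OF x(1)] cU by (intro le_antisym) (auto simp: Q_def)
    ultimately have gb: "g b = b" by simp
    have "b \<in> S" using upS[OF x(1)] x(2) by simp
    then have "set (u @ bs) \<subseteq> S" using upS bs by auto
    moreover have "map g bs = bs" using gb g_id bs by (intro map_idI) metis
    ultimately show ?thesis using g gu by (intro exI[of _ S] exI[of _ g]) simp
  next
    case False
    define S' where "S' = {t \<in> S. \<forall>x\<in>{b}. (t \<sqinter> c \<sqsubset> x \<and> g t \<sqinter> c \<sqsubset> x) \<or> (x \<sqsubset> t \<sqinter> c \<and> x \<sqsubset> g t \<sqinter> c)}"
    define h where "h t = (if t \<in> {b} then t else g t)" for t
    have "partial_embedding (S' \<union> {b}) h"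
      unfolding S'_def h_def
      using partial_embedding_move[OF g cS gc, of "{b}" "\<lambda>x. x"] b by simp
    moreover have "x \<in> S'" if x: "x \<in> set u \<union> set ps" for x
    proof -
      have *: "x \<sqinter> c \<sqsubseteq> c" "g x \<sqinter> c \<sqsubseteq> c" "x \<sqinter> c \<in> U" "g x \<sqinter> c \<in> U" "x \<sqinter> c \<noteq> b"
        using upU[OF x] cU False x by (auto simp: meet_le)
      have "\<not> (x \<sqinter> c \<sqsubseteq> b \<and> b \<sqsubseteq> x \<sqinter> c)" using * b le_antisym by blast
      then consider "\<not> x \<sqinter> c \<sqsubseteq> b" "\<not> g x \<sqinter> c \<sqsubseteq> b" | "\<not> b \<sqsubseteq> x \<sqinter> c" "\<not> b \<sqsubseteq> g x \<sqinter> c"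
        using Q[OF x] by (auto simp: Q_def)
      then show ?thesis
        using upS[OF x] * b cU not_le_iff_below[of "x \<sqinter> c" c b] not_le_iff_below[of "g x \<sqinter> c" c b]
          not_le_iff_below[of b c "x \<sqinter> c"] not_le_iff_below[of b c "g x \<sqinter> c"]
        by cases (auto simp: S'_def)
    qed
    moreover have "b \<notin> set u \<union> set ps" using False meet_absorb[OF b(1) cU] by blast
    ultimately show ?thesis
      using gu g_id bs
      by (intro exI[of _ "S' \<union> {b}"] exI[of _ h]) (auto simp: h_def intro!: map_idI)
  qed
  then obtain S' h where "partial_embedding S' h" "set (u @ bs) \<subseteq> S'" "map h (u @ bs) = v @ bs" by blast
  then show "sat A (nth (concat (map a is) @ bs)) \<phi> = sat A (nth (concat (map a js) @ bs)) \<phi>"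
    using partial_embedding_sat[of S' h "u @ bs" \<phi>] \<phi> len by (simp add: u_def v_def)
qed (use indiscernibleD[OF ind] in auto)

text \<open>
  A failure of the hypothesis of \<open>indiscernible_insert_below\<close>, normalised by linearity of the chain: two
  different projections, one on each side of \<open>b\<close>, where one of them may be \<open>b\<close> itself.
\<close>

lemma splitting_coordinate:
  assumes ind: "indiscernible (star_lang L) A P m I a"
    and P: "P \<subseteq> U" "c \<in> P" and b: "b \<in> U" "b \<sqsubset> c"
    and not: "\<not> indiscernible (star_lang L) A (insert b P) m I a"
  obtains s i j where "s < m" "i \<in> I" "j \<in> I" "a i ! s \<in> U" "a j ! s \<in> U"
    "a i ! s \<sqinter> c \<sqsubseteq> b" "b \<sqsubseteq> a j ! s \<sqinter> c" "a i ! s \<sqinter> c \<noteq> a j ! s \<sqinter> c"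
proof -
  have aU: "a i ! s \<in> U" if "i \<in> I" "s < m" for i s
    using indiscernibleD(1,2)[OF ind that(1)] that(2) by (auto simp: subset_iff)
  have cU: "c \<in> U" "b \<sqsubseteq> c" using P b by (auto simp: less_def)
  obtain i j s where s: "s < m" "i \<in> I" "j \<in> I"
    and ne: "(a i ! s \<sqinter> c \<sqsubseteq> b \<longleftrightarrow> a j ! s \<sqinter> c \<sqsubseteq> b) \<longrightarrow> \<not> (b \<sqsubseteq> a i ! s \<sqinter> c \<longleftrightarrow> b \<sqsubseteq> a j ! s \<sqinter> c)"
    using indiscernible_insert_below[OF ind P b] not by blast
  have U: "a i ! s \<in> U" "a j ! s \<in> U" using aU s by auto
  have lin: "x \<sqinter> c \<sqsubseteq> b \<or> b \<sqsubseteq> x \<sqinter> c" if "x \<in> U" for x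
    using le_linear_below[of "x \<sqinter> c" c b] that b cU by (simp add: meet_le)
  have "a i ! s \<sqinter> c \<noteq> a j ! s \<sqinter> c" using ne by metis
  moreover have "(a i ! s \<sqinter> c \<sqsubseteq> b \<and> b \<sqsubseteq> a j ! s \<sqinter> c) \<or> (a j ! s \<sqinter> c \<sqsubseteq> b \<and> b \<sqsubseteq> a i ! s \<sqinter> c)"
    using ne lin[OF U(1)] lin[OF U(2)] by blast
  ultimately show thesis using that s U by metis
qed

lemma mutually_indiscernible_coordinates:
  assumes ind: "indiscernible (star_lang L) A (P \<union> (\<Union>j\<in>J. set (a' j))) m I a"
    and J: "\<And>j. j \<in> J \<Longrightarrow> length (a' j) = m'" and c: "c \<in> P"
    and ij: "i \<in> I" "i' \<in> I" "j \<in> J" "s < m" "s' < m'"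
  shows "a i ! s \<sqinter> c \<sqsubseteq> a' j ! s' \<sqinter> c \<longleftrightarrow> a i' ! s \<sqinter> c \<sqsubseteq> a' j ! s' \<sqinter> c"
    and "a' j ! s' \<sqinter> c \<sqsubseteq> a i ! s \<sqinter> c \<longleftrightarrow> a' j ! s' \<sqinter> c \<sqsubseteq> a i' ! s \<sqinter> c"
proof -
  let ?s = "meet_tm (Var s) (Var (Suc m))" and ?t = "meet_tm (Var m) (Var (Suc m))"
  have len: "length (a i) = m" "length (a i') = m" using indiscernibleD(1)[OF ind] ij by auto
  have bs: "set [a' j ! s', c] \<subseteq> P \<union> (\<Union>j\<in>J. set (a' j))" using J c ij by force
  have "sat A (nth (concat (map a [i]) @ [a' j ! s', c])) \<phi> =
      sat A (nth (concat (map a [i']) @ [a' j ! s', c])) \<phi>"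
    if "\<phi> = leq_fm ?s ?t \<or> \<phi> = leq_fm ?t ?s" for \<phi>
    by (rule indiscernibleD(3)[OF ind _ _ _ _ _ _ bs]) (use that ij in auto)
  from this[of "leq_fm ?s ?t"] this[of "leq_fm ?t ?s"]
  show "a i ! s \<sqinter> c \<sqsubseteq> a' j ! s' \<sqinter> c \<longleftrightarrow> a i' ! s \<sqinter> c \<sqsubseteq> a' j ! s' \<sqinter> c"
    and "a' j ! s' \<sqinter> c \<sqsubseteq> a i ! s \<sqinter> c \<longleftrightarrow> a' j ! s' \<sqinter> c \<sqsubseteq> a i' ! s \<sqinter> c"
    using len ij by (simp_all add: nth_append)
qed

text \<open>
  Let \<open>b\<close> separate projections \<open>x \<sqsubseteq> b \<sqsubseteq> x'\<close> of the first sequence and \<open>y \<sqsubseteq> b \<sqsubseteq> y'\<close> of the second. Then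
  \<open>x \<sqsubseteq> y'\<close> and \<open>y \<sqsubseteq> x'\<close>, and by mutual indiscernibility these inequalities hold between all projections
  of the two coordinates. Hence \<open>x' \<sqsubseteq> y \<sqsubseteq> b\<close> and \<open>b \<sqsubseteq> y' \<sqsubseteq> x\<close>, so that \<open>x = b = x'\<close>.
\<close>

lemma mutually_indiscernible_below:
  assumes mut: "mutually_indiscernible (star_lang L) A P m I a m' J a'"
    and P: "P \<subseteq> U" "c \<in> P" and b: "b \<in> U" "b \<sqsubset> c"
  shows "indiscernible (star_lang L) A (insert b P) m I a \<or>
    indiscernible (star_lang L) A (insert b P) m' J a'"
proof (rule ccontr)
  assume "\<not> ?thesis"
  then have not: "\<not> indiscernible (star_lang L) A (insert b P) m I a"
    "\<not> indiscernible (star_lang L) A (insert b P) m' J a'" by auto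
  have ind: "indiscernible (star_lang L) A (P \<union> (\<Union>j\<in>J. set (a' j))) m I a"
    "indiscernible (star_lang L) A (P \<union> (\<Union>i\<in>I. set (a i))) m' J a'"
    using mut by (auto simp: mutually_indiscernible_def)
  then have indP: "indiscernible (star_lang L) A P m I a" "indiscernible (star_lang L) A P m' J a'"
    using indiscernible_mono by blast+
  obtain s i i' where s: "s < m" "i \<in> I" "i' \<in> I" "a i ! s \<in> U" "a i' ! s \<in> U"
    and f: "a i ! s \<sqinter> c \<sqsubseteq> b" "b \<sqsubseteq> a i' ! s \<sqinter> c" "a i ! s \<sqinter> c \<noteq> a i' ! s \<sqinter> c"
    using splitting_coordinate[OF indP(1) P b not(1)] by blast
  obtain s' j j' where s': "s' < m'" "j \<in> J" "j' \<in> J" "a' j ! s' \<in> U" "a' j' ! s' \<in> U"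
    and f': "a' j ! s' \<sqinter> c \<sqsubseteq> b" "b \<sqsubseteq> a' j' ! s' \<sqinter> c" "a' j ! s' \<sqinter> c \<noteq> a' j' ! s' \<sqinter> c"
    using splitting_coordinate[OF indP(2) P b not(2)] by blast
  have cU: "c \<in> U" using P by blast
  note U = meet_in[OF s(4) cU] meet_in[OF s(5) cU] meet_in[OF s'(4) cU] meet_in[OF s'(5) cU] b(1)
  have len: "\<And>i. i \<in> I \<Longrightarrow> length (a i) = m" "\<And>j. j \<in> J \<Longrightarrow> length (a' j) = m'"
    using indP indiscernibleD(1) by blast+
  have le: "a i ! s \<sqinter> c \<sqsubseteq> a' j ! s' \<sqinter> c" "a i' ! s \<sqinter> c \<sqsubseteq> a' j ! s' \<sqinter> c"
    "a' j' ! s' \<sqinter> c \<sqsubseteq> a i ! s \<sqinter> c"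
  proof -
    have "a i ! s \<sqinter> c \<sqsubseteq> a' j' ! s' \<sqinter> c" "a' j ! s' \<sqinter> c \<sqsubseteq> a i' ! s \<sqinter> c"
      using le_trans[OF f(1) f'(2)] le_trans[OF f'(1) f(2)] U by auto
    then show "a i ! s \<sqinter> c \<sqsubseteq> a' j ! s' \<sqinter> c" "a i' ! s \<sqinter> c \<sqsubseteq> a' j ! s' \<sqinter> c"
      "a' j' ! s' \<sqinter> c \<sqsubseteq> a i ! s \<sqinter> c"
      using mutually_indiscernible_coordinates[OF ind(1) len(2) P(2), of _ _ _ s s']
        mutually_indiscernible_coordinates[OF ind(2) len(1) P(2), of _ _ _ s' s] s s' by metis+
  qed
  have "a i' ! s \<sqinter> c \<sqsubseteq> b" using le_trans[OF le(2) f'(1)] U by blast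
  then have "a i' ! s \<sqinter> c = b" using f(2) le_antisym U by blast
  moreover have "b \<sqsubseteq> a i ! s \<sqinter> c" using le_trans[OF f'(2) le(3)] U by blast
  then have "a i ! s \<sqinter> c = b" using f(1) le_antisym U by blast
  ultimately show False using f(3) by simp
qed

lemma no_endpoints_splits_at:
  assumes "splits_at I k" "i \<in> I"
  obtains j j' where "j \<in> I" "j' \<in> I" "j < i" "i < j'"
proof -
  consider "i < k" | "i = k" | "k < i" by fastforce
  then have "(\<exists>j\<in>I. j < i) \<and> (\<exists>j\<in>I. i < j)"
  proof cases
    case 2
    have "{i \<in> I. i < k} \<noteq> {}" "{i \<in> I. k < i} \<noteq> {}"
      using assms(1) unfolding splits_at_def by force+
    then show ?thesis using 2 by blast
  qed (use assms in \<open>auto simp: splits_at_def no_endpoints_def\<close>)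
  then show thesis using that by blast
qed

text \<open>
  The projections of one coordinate form a monotone sequence, so the one at \<open>k\<close> lies between those at
  two neighbours \<open>l < k < r\<close>, which have the same position relative to \<open>b\<close>.
\<close>

lemma indiscernible_fill_gap_below:
  assumes sp: "splits_at I k" and ind: "indiscernible (star_lang L) A P m I a"
    and P: "P \<subseteq> U" "c \<in> P" and b: "b \<in> U" "b \<sqsubset> c"
    and ind': "indiscernible (star_lang L) A (insert b P) m (I - {k}) a"
  shows "indiscernible (star_lang L) A (insert b P) m I a"
proof (rule indiscernible_insert_below[OF ind P b])
  fix i j s assume ij: "i \<in> I" "j \<in> I" and s: "s < m"
  have k: "k \<in> I" using sp by (simp add: splits_at_def)
  obtain l r where lr: "l \<in> I" "r \<in> I" "l < k" "k < r" using no_endpoints_splits_at[OF sp k] .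
  have aU: "a i ! s \<in> U" "length (a i) = m" if "i \<in> I" for i
    using indiscernibleD(1,2)[OF ind that(1)] s by (auto simp: subset_iff)
  have cU: "c \<in> U" using P by blast
  define x where "x i = a i ! s \<sqinter> c" for i
  have xU: "x i \<in> U" "x i \<sqsubseteq> c" if "i \<in> I" for i using aU that cU by (auto simp: x_def meet_le)
  define Q where "Q y z \<longleftrightarrow> (y \<sqsubseteq> b \<longleftrightarrow> z \<sqsubseteq> b) \<and> (b \<sqsubseteq> y \<longleftrightarrow> b \<sqsubseteq> z)" for y z
  have pos: "Q (x i) (x j)" if ij: "i \<in> I - {k}" "j \<in> I - {k}" for i j
  proof -
    let ?s = "meet_tm (Var s) (Var (Suc m))" and ?t = "Var m"
    have bs: "set [b, c] \<subseteq> insert b P" using P by simp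
    have "sat A (nth (concat (map a [i]) @ [b, c])) \<phi> = sat A (nth (concat (map a [j]) @ [b, c])) \<phi>"
      if "\<phi> = leq_fm ?s ?t \<or> \<phi> = leq_fm ?t ?s" for \<phi>
      by (rule indiscernibleD(3)[OF ind' _ _ _ _ _ _ bs]) (use that ij s in auto)
    from this[of "leq_fm ?s ?t"] this[of "leq_fm ?t ?s"]
    show ?thesis using aU ij s by (simp add: nth_append Q_def x_def)
  qed
  have mono: "(x l \<sqsubseteq> x k \<longleftrightarrow> x k \<sqsubseteq> x r) \<and> (x k \<sqsubseteq> x l \<longleftrightarrow> x r \<sqsubseteq> x k)"
  proof -
    let ?s = "meet_tm (Var s) (Var (m + m))" and ?t = "meet_tm (Var (m + s)) (Var (m + m))"
    have bs: "set [c] \<subseteq> P" using P by simp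
    have "sat A (nth (concat (map a [l, k]) @ [c])) \<phi> = sat A (nth (concat (map a [k, r]) @ [c])) \<phi>"
      if "\<phi> = leq_fm ?s ?t \<or> \<phi> = leq_fm ?t ?s" for \<phi>
      by (rule indiscernibleD(3)[OF ind _ _ _ _ _ _ bs]) (use that lr k s in auto)
    from this[of "leq_fm ?s ?t"] this[of "leq_fm ?t ?s"]
    show ?thesis using aU lr k s by (simp add: nth_append x_def)
  qed
  have "x l \<sqsubseteq> x k \<or> x k \<sqsubseteq> x l" using le_linear_below[of "x l" c "x k"] xU lr k cU by blast
  then consider "x l \<sqsubseteq> x k" "x k \<sqsubseteq> x r" | "x r \<sqsubseteq> x k" "x k \<sqsubseteq> x l" using mono by blast
  moreover have "Q (x l) (x r)" using pos lr by auto
  ultimately have "Q (x l) (x k)"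
    using le_trans xU lr k b unfolding Q_def by cases metis+
  then have "Q (x l) (x i)" if "i \<in> I" for i
    using pos[of l i] that lr by (cases "i = k") auto
  then have "Q (x i) (x j)" using ij unfolding Q_def by metis
  then show "(a i ! s \<sqinter> c \<sqsubseteq> b \<longleftrightarrow> a j ! s \<sqinter> c \<sqsubseteq> b) \<and> (b \<sqsubseteq> a i ! s \<sqinter> c \<longleftrightarrow> b \<sqsubseteq> a j ! s \<sqinter> c)"
    by (simp add: Q_def x_def)
qed

section \<open>Sequences of points of the chain\<close>

text \<open>
  The instance of \<open>partial_embedding_move\<close> in which the points \<open>xs\<close> move to \<open>ys\<close> and everything else
  that is kept in the domain is fixed.
\<close>

lemma partial_embedding_move_list:
  assumes c: "c \<in> U" and d: "set d \<subseteq> U"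
    and len: "length xs = length ys" "distinct xs"
    and xs: "\<And>x. x \<in> set xs \<union> set ys \<Longrightarrow> x \<in> U \<and> x \<sqsubset> c"
    and order: "\<And>p q. p < length xs \<Longrightarrow> q < length xs \<Longrightarrow> xs ! p \<sqsubseteq> xs ! q \<longleftrightarrow> ys ! p \<sqsubseteq> ys ! q"
    and colour: "\<And>R p. R \<in> rsyms L \<Longrightarrow> p < length xs \<Longrightarrow>
      rint A (Star R) (xs ! p # replicate (rarity L R) c) = rint A (Star R) (ys ! p # replicate (rarity L R) c)"
    and sep: "\<And>e p. e \<in> set d \<Longrightarrow> p < length xs \<Longrightarrow>
      (e \<sqinter> c \<sqsubset> xs ! p \<and> e \<sqinter> c \<sqsubset> ys ! p) \<or> (xs ! p \<sqsubset> e \<sqinter> c \<and> ys ! p \<sqsubset> e \<sqinter> c)"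
  obtains S h where "partial_embedding S h" "set xs \<union> set d \<subseteq> S" "map h xs = ys" "map h d = d"
proof -
  define f where "f x = the (map_of (zip xs ys) x)" for x
  have f: "f (xs ! p) = ys ! p" if "p < length xs" for p
    using map_of_zip_nth[OF len, of p] that len by (simp add: f_def)
  define S where "S = {t \<in> U. \<forall>x\<in>set xs. (t \<sqinter> c \<sqsubset> x \<and> t \<sqinter> c \<sqsubset> f x) \<or> (x \<sqsubset> t \<sqinter> c \<and> f x \<sqsubset> t \<sqinter> c)}"
  define h where "h t = (if t \<in> set xs then f t else t)" for t
  have "partial_embedding U (\<lambda>t. t)" by (simp add: partial_embedding_def meet_closed_def)
  note move = partial_embedding_move[OF this c refl, of "set xs" f]
  have nth: "ys ! p \<in> set ys" if "p < length xs" for p using that len by simp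
  have "partial_embedding (S \<union> set xs) h"
    unfolding S_def h_def
  proof (rule move)
    show "set xs \<subseteq> U" "\<And>x. x \<in> set xs \<Longrightarrow> x \<sqsubset> c" using xs by auto
    show "f ` set xs \<subseteq> U" "\<And>x. x \<in> set xs \<Longrightarrow> f x \<sqsubset> c"
      using xs nth f by (auto simp: in_set_conv_nth)
    show "x \<sqsubseteq> y \<longleftrightarrow> f x \<sqsubseteq> f y" if "x \<in> set xs" "y \<in> set xs" for x y
      using that order f by (auto simp: in_set_conv_nth)
    show "rint A (Star R) (x # replicate (rarity L R) c) = rint A (Star R) (f x # replicate (rarity L R) c)"
      if "R \<in> rsyms L" "x \<in> set xs" for R x
      using that colour f by (auto simp: in_set_conv_nth)
  qed
  moreover have dS: "e \<in> S" "e \<notin> set xs" if "e \<in> set d" for e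
  proof -
    have "(e \<sqinter> c \<sqsubset> x \<and> e \<sqinter> c \<sqsubset> f x) \<or> (x \<sqsubset> e \<sqinter> c \<and> f x \<sqsubset> e \<sqinter> c)" if x: "x \<in> set xs" for x
    proof -
      obtain p where "p < length xs" "xs ! p = x" using x by (auto simp: in_set_conv_nth)
      then show ?thesis using sep[OF \<open>e \<in> set d\<close>, of p] f[of p] by auto
    qed
    then show "e \<in> S" using that d by (auto simp: S_def)
    show "e \<notin> set xs"
    proof
      assume e: "e \<in> set xs"
      then obtain p where "p < length xs" "xs ! p = e" by (auto simp: in_set_conv_nth)
      moreover have "e \<sqinter> c = e" using e xs c by (auto simp: less_def meet_absorb)
      ultimately show False using sep[OF that, of p] by (auto simp: less_def)
    qed
  qed
  moreover have "map h xs = ys" using f len by (auto simp: h_def intro!: nth_equalityI)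
  moreover have "map h d = d" using dS by (auto simp: h_def intro!: map_idI)
  ultimately show thesis using that[of "S \<union> set xs" h] by auto
qed

lemma star_replicate:
  assumes "R \<in> rsyms L" "x \<in> U" "y \<in> U" "c \<in> U" "x \<sqsubset> y \<sqinter> c"
  shows "rint A (Star R) (x # replicate (rarity L R) y) = rint A (Star R) (x # replicate (rarity L R) c)"
  using assms by (intro star_cong) (auto simp: list_all2_conv_all_nth)

lemma monotone_sequence:
  fixes I :: "'i::linorder set"
  assumes ind: "indiscernible (star_lang L) A P 1 I a" and a: "\<And>i. i \<in> I \<Longrightarrow> a i = [x i]"
    and x: "\<And>i. i \<in> I \<Longrightarrow> x i \<in> U \<and> x i \<sqsubset> c" and c: "c \<in> U"
  shows "(\<forall>i\<in>I. \<forall>j\<in>I. x i = x j) \<or> (\<forall>i\<in>I. \<forall>j\<in>I. i < j \<longrightarrow> x i \<sqsubset> x j) \<or>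
    (\<forall>i\<in>I. \<forall>j\<in>I. i < j \<longrightarrow> x j \<sqsubset> x i)"
proof -
  have pair: "(x i \<sqsubseteq> x j \<longleftrightarrow> x i' \<sqsubseteq> x j') \<and> (x j \<sqsubseteq> x i \<longleftrightarrow> x j' \<sqsubseteq> x i')"
    if "i \<in> I" "j \<in> I" "i < j" "i' \<in> I" "j' \<in> I" "i' < j'" for i j i' j'
  proof -
    have "sat A (nth (concat (map a [i, j]) @ [])) \<phi> = sat A (nth (concat (map a [i', j']) @ [])) \<phi>"
      if "\<phi> = leq_fm (Var 0) (Var 1) \<or> \<phi> = leq_fm (Var 1) (Var 0)" for \<phi>
      by (rule indiscernibleD(3)[OF ind]) (use that \<open>i \<in> I\<close> \<open>j \<in> I\<close> \<open>i < j\<close> \<open>i' \<in> I\<close> \<open>j' \<in> I\<close> \<open>i' < j'\<close> in auto)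
    from this[of "leq_fm (Var 0) (Var 1)"] this[of "leq_fm (Var 1) (Var 0)"]
    show ?thesis using a that by simp
  qed
  have lin: "x i = x j \<or> x i \<sqsubset> x j \<or> x j \<sqsubset> x i" if "i \<in> I" "j \<in> I" for i j
    using le_linear_below[of "x i" c "x j"] x[OF that(1)] x[OF that(2)] c by (auto simp: less_def)
  have anti: "x i = x j \<longleftrightarrow> x i \<sqsubseteq> x j \<and> x j \<sqsubseteq> x i" if "i \<in> I" "j \<in> I" for i j
    using le_antisym[of "x i" "x j"] x[OF that(1)] x[OF that(2)] by auto
  show ?thesis
  proof (cases "\<exists>i\<in>I. \<exists>j\<in>I. i < j")
    case False
    then have "i = j" if "i \<in> I" "j \<in> I" for i j using that by (metis linorder_neqE)
    then have "x i = x j" if "i \<in> I" "j \<in> I" for i j using that by metis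
    then show ?thesis by blast
  next
    case True
    then obtain i j where ij: "i \<in> I" "j \<in> I" "i < j" by blast
    consider "x i = x j" | "x i \<sqsubset> x j" | "x j \<sqsubset> x i" using lin ij by blast
    then show ?thesis
    proof cases
      case 1
      then have "x i' = x j'" if "i' \<in> I" "j' \<in> I" "i' < j'" for i' j'
        using pair[OF ij that] anti ij that by blast
      then show ?thesis by (metis linorder_neqE)
    next
      case 2
      then have "x i' \<sqsubset> x j'" if "i' \<in> I" "j' \<in> I" "i' < j'" for i' j'
        using pair[OF ij that] anti ij that unfolding less_def by blast
      then show ?thesis by blast
    next
      case 3
      then have "x j' \<sqsubset> x i'" if "i' \<in> I" "j' \<in> I" "i' < j'" for i' j'
        using pair[OF ij that] anti[of i j] anti[of i' j'] ij that unfolding less_def by metis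
      then show ?thesis by blast
    qed
  qed
qed

text \<open>
  The colour of \<open>x\<^sub>i\<close> refers to \<open>c\<close>, over which the sequence need not be indiscernible. But a larger point
  \<open>x\<^sub>j\<close> of the sequence lies in the same cone above \<open>x\<^sub>i\<close> and can replace \<open>c\<close>.
\<close>

lemma constant_colour:
  fixes I :: "'i::linorder set"
  assumes ind: "indiscernible (star_lang L) A P 1 I a" and a: "\<And>i. i \<in> I \<Longrightarrow> a i = [x i]"
    and x: "\<And>i. i \<in> I \<Longrightarrow> x i \<in> U \<and> x i \<sqsubset> c" and c: "c \<in> U"
    and ne: "\<And>i. i \<in> I \<Longrightarrow> (\<exists>j\<in>I. j < i) \<and> (\<exists>j\<in>I. i < j)"
    and mono: "(\<forall>i\<in>I. \<forall>j\<in>I. i < j \<longrightarrow> x i \<sqsubset> x j) \<or> (\<forall>i\<in>I. \<forall>j\<in>I. i < j \<longrightarrow> x j \<sqsubset> x i)"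
    and R: "R \<in> rsyms L" and ij: "i \<in> I" "j \<in> I"
  shows "rint A (Star R) (x i # replicate (rarity L R) c) = rint A (Star R) (x j # replicate (rarity L R) c)"
proof -
  have col: "rint A (Star R) (x k # replicate (rarity L R) (x l)) =
      rint A (Star R) (x k # replicate (rarity L R) c)" if "k \<in> I" "l \<in> I" "x k \<sqsubset> x l" for k l
    using that x c R by (intro star_replicate) (auto simp: less_def meet_absorb)
  show ?thesis
    using mono
  proof
    assume inc: "\<forall>i\<in>I. \<forall>j\<in>I. i < j \<longrightarrow> x i \<sqsubset> x j"
    obtain i' j' where i': "i' \<in> I" "i < i'" and j': "j' \<in> I" "j < j'" using ne ij by meson
    let ?\<phi> = "Rel (Star R) (Var 0 # replicate (rarity L R) (Var 1))"
    have "sat A (nth (concat (map a [i, i']) @ [])) ?\<phi> = sat A (nth (concat (map a [j, j']) @ [])) ?\<phi>"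
      by (rule indiscernibleD(3)[OF ind]) (use i' j' ij R in auto)
    then show ?thesis using a i' j' ij inc col[of i i'] col[of j j'] by (simp add: map_replicate_const)
  next
    assume dec: "\<forall>i\<in>I. \<forall>j\<in>I. i < j \<longrightarrow> x j \<sqsubset> x i"
    obtain i' j' where i': "i' \<in> I" "i' < i" and j': "j' \<in> I" "j' < j" using ne ij by meson
    let ?\<phi> = "Rel (Star R) (Var 1 # replicate (rarity L R) (Var 0))"
    have "sat A (nth (concat (map a [i', i]) @ [])) ?\<phi> = sat A (nth (concat (map a [j', j]) @ [])) ?\<phi>"
      by (rule indiscernibleD(3)[OF ind]) (use i' j' ij R in auto)
    then show ?thesis using a i' j' ij dec col[of i i'] col[of j j'] by (simp add: map_replicate_const)
  qed
qed

text \<open>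
  If the sequence is not constant, then for \<open>e\<close> in \<open>d\<close> either all points are below \<open>e\<close> or none is: this
  holds off \<open>k\<close> by assumption, and at \<open>k\<close> by monotonicity. As there is no last or first point, no
  projection \<open>e \<sqinter> c\<close> equals a point or separates two points, and any two subsequences of the same
  length can be moved to each other over \<open>d\<close>.
\<close>

lemma indiscernible_fill_gap_chain:
  fixes I :: "'i::linorder set"
  assumes sp: "splits_at I k"
    and ind: "indiscernible (star_lang L) A {} 1 I a" and a: "\<And>i. i \<in> I \<Longrightarrow> a i = [x i]"
    and x: "\<And>i. i \<in> I \<Longrightarrow> x i \<in> U \<and> x i \<sqsubset> c" and c: "c \<in> U"
    and d: "set d \<subseteq> U" and ind': "indiscernible (star_lang L) A (set d) 1 (I - {k}) a"
  shows "indiscernible (star_lang L) A (set d) 1 I a"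
proof (rule indiscernibleI)
  fix "is" js \<phi> bs
  assume "is": "set is \<subseteq> I" "set js \<subseteq> I" "sorted_wrt (<) is" "sorted_wrt (<) js" "length is = length js"
    and \<phi>: "is_fm (star_lang L) \<phi>" "set bs \<subseteq> set d" "free_vars \<phi> \<subseteq> {..<length is * 1 + length bs}"
  have k: "k \<in> I" using sp by (simp add: splits_at_def)
  have ne: "(\<exists>j\<in>I. j < i) \<and> (\<exists>j\<in>I. i < j)" if "i \<in> I" for i
    using no_endpoints_splits_at[OF sp that] by metis
  have concat: "concat (map a ks) = map x ks" if "set ks \<subseteq> I" for ks
    using that a by (induction ks) auto
  consider "\<forall>i\<in>I. \<forall>j\<in>I. x i = x j"
    | "(\<forall>i\<in>I. \<forall>j\<in>I. i < j \<longrightarrow> x i \<sqsubset> x j) \<or> (\<forall>i\<in>I. \<forall>j\<in>I. i < j \<longrightarrow> x j \<sqsubset> x i)"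
    using monotone_sequence[OF ind a x c] by blast
  then show "sat A (nth (concat (map a is) @ bs)) \<phi> = sat A (nth (concat (map a js) @ bs)) \<phi>"
  proof cases
    case 1
    then have "map x is = map x js"
      using "is" by (intro nth_equalityI) (auto simp: subset_iff)
    then show ?thesis using concat "is" by simp
  next
    case mono: 2
    have ord: "x i \<sqsubseteq> x j \<longleftrightarrow> x i' \<sqsubseteq> x j'"
      if "i \<in> I" "j \<in> I" "i' \<in> I" "j' \<in> I" "i < j \<longleftrightarrow> i' < j'" "j < i \<longleftrightarrow> j' < i'" for i j i' j'
    proof -
      have *: "x p \<sqsubset> x q \<Longrightarrow> \<not> x q \<sqsubseteq> x p" if "p \<in> I" "q \<in> I" for p q
        using less_not_le x that by blast
      have "i < j \<or> i = j \<or> j < i" by auto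
      then show ?thesis
        using mono that x *[of i j] *[of j i] *[of i' j'] *[of j' i'] unfolding less_def
        by (metis le_refl linorder_neqE)
    qed
    have above: "\<exists>j\<in>I. x i \<sqsubset> x j" and below: "\<exists>j\<in>I. x j \<sqsubset> x i" if "i \<in> I" for i
      using mono ne[OF that] that by blast+
    have cut: "(\<forall>i\<in>I. x i \<sqsubseteq> e) \<or> (\<forall>i\<in>I. \<not> x i \<sqsubseteq> e)" if e: "e \<in> set d" for e
    proof -
      have eU: "e \<in> U" using e d by blast
      have const: "x i \<sqsubseteq> e \<longleftrightarrow> x j \<sqsubseteq> e" if ij: "i \<in> I - {k}" "j \<in> I - {k}" for i j
      proof -
        have "sat A (nth (concat (map a [i]) @ [e])) (leq_fm (Var 0) (Var 1)) =
            sat A (nth (concat (map a [j]) @ [e])) (leq_fm (Var 0) (Var 1))"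
          by (rule indiscernibleD(3)[OF ind']) (use ij e in auto)
        then show ?thesis using a ij by simp
      qed
      obtain l r where lr: "l \<in> I" "r \<in> I" "x l \<sqsubset> x k" "x k \<sqsubset> x r" using above[OF k] below[OF k] by blast
      then have ne: "l \<noteq> k" "r \<noteq> k" by (auto simp: less_def)
      have "x l \<sqsubseteq> e" if "x k \<sqsubseteq> e" using le_trans[OF _ that, of "x l"] lr x k eU by (auto simp: less_def)
      moreover have "x k \<sqsubseteq> e" if "x r \<sqsubseteq> e" using le_trans[OF _ that, of "x k"] lr x k eU by (auto simp: less_def)
      moreover have "x l \<sqsubseteq> e \<longleftrightarrow> x r \<sqsubseteq> e" using const lr ne by blast
      ultimately have "x i \<sqsubseteq> e \<longleftrightarrow> x l \<sqsubseteq> e" if "i \<in> I" for i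
        using const[of i l] lr ne that by (cases "i = k") auto
      then show ?thesis by blast
    qed
    have sep: "(e \<sqinter> c \<sqsubset> x i \<and> e \<sqinter> c \<sqsubset> x j) \<or> (x i \<sqsubset> e \<sqinter> c \<and> x j \<sqsubset> e \<sqinter> c)"
      if e: "e \<in> set d" and ij: "i \<in> I" "j \<in> I" for e i j
    proof -
      have eU: "e \<in> U" using e d by blast
      have xc: "x i \<in> U" "x i \<sqsubseteq> c" if "i \<in> I" for i using x[OF that] by (auto simp: less_def)
      from cut[OF e] show ?thesis
      proof
        assume all: "\<forall>i\<in>I. x i \<sqsubseteq> e"
        have "x i \<sqsubset> e \<sqinter> c" if i: "i \<in> I" for i
        proof -
          obtain r where r: "r \<in> I" "x i \<sqsubset> x r" using above[OF i] by blast
          then have "x r \<sqsubseteq> e \<sqinter> c" using all xc[OF r(1)] eU c by (simp add: le_meet_iff)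
          then show ?thesis using less_le_trans[OF r(2)] xc i r eU c by blast
        qed
        then show ?thesis using ij by blast
      next
        assume none: "\<forall>i\<in>I. \<not> x i \<sqsubseteq> e"
        have "e \<sqinter> c \<sqsubset> x i" if i: "i \<in> I" for i
        proof -
          have "\<not> x i \<sqsubseteq> e \<sqinter> c" using none i xc[OF i] eU c by (simp add: le_meet_iff)
          then show ?thesis
            using not_le_iff_below[of "x i" c "e \<sqinter> c"] xc[OF i] eU c by (simp add: meet_le)
        qed
        then show ?thesis using ij by blast
      qed
    qed
    define xs ys where "xs = map x is" and "ys = map x js"
    have len: "length xs = length is" "length ys = length is" using "is" by (auto simp: xs_def ys_def)
    have nthI: "is ! p \<in> I" "js ! p \<in> I" if "p < length is" for p
      using "is" that nth_mem[of p "is"] nth_mem[of p js] by auto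
    have lt: "is ! p < is ! q \<longleftrightarrow> p < q" "js ! p < js ! q \<longleftrightarrow> p < q" if "p < length is" "q < length is" for p q
      using "is" that sorted_wrt_nth_less[of "(<)" "is"] sorted_wrt_nth_less[of "(<)" js]
      by (metis linorder_neqE_nat order_less_asym order_less_irrefl)+
    have dist: "distinct xs"
    proof -
      have "x i \<noteq> x j" if "i \<in> I" "j \<in> I" "i < j" for i j
        using mono that unfolding less_def by metis
      then have "inj_on x I" by (intro inj_onI) (metis linorder_neqE)
      moreover have "distinct is" using "is" strict_sorted_iff by blast
      ultimately show ?thesis using "is" unfolding xs_def by (simp add: distinct_map inj_on_subset)
    qed
    have 1: "e \<in> U \<and> e \<sqsubset> c" if "e \<in> set xs \<union> set ys" for e
      using that x "is" by (auto simp: xs_def ys_def)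
    have 2: "xs ! p \<sqsubseteq> xs ! q \<longleftrightarrow> ys ! p \<sqsubseteq> ys ! q" if "p < length xs" "q < length xs" for p q
      using ord[of "is ! p" "is ! q" "js ! p" "js ! q"] that len "is" nthI lt
      by (auto simp: xs_def ys_def)
    have 3: "rint A (Star R) (xs ! p # replicate (rarity L R) c) = rint A (Star R) (ys ! p # replicate (rarity L R) c)"
      if "R \<in> rsyms L" "p < length xs" for R p
      using constant_colour[OF ind a x c ne mono that(1) nthI] that len "is" by (auto simp: xs_def ys_def)
    have 4: "(e \<sqinter> c \<sqsubset> xs ! p \<and> e \<sqinter> c \<sqsubset> ys ! p) \<or> (xs ! p \<sqsubset> e \<sqinter> c \<and> ys ! p \<sqsubset> e \<sqinter> c)"
      if "e \<in> set d" "p < length xs" for e p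
      using sep[OF that(1) nthI] that len "is" by (auto simp: xs_def ys_def)
    obtain S h where h: "partial_embedding S h" "set xs \<union> set d \<subseteq> S" "map h xs = ys" "map h d = d"
      using partial_embedding_move_list[of c d xs ys, OF c d _ dist 1 2 3 4] len by auto
    have "map h bs = bs" using h(4) \<phi>(2) by (intro map_idI) (metis (no_types) in_set_conv_nth nth_map subsetD)
    moreover have "set (xs @ bs) \<subseteq> S" using h(2) \<phi>(2) by auto
    ultimately show ?thesis
      using partial_embedding_sat[OF h(1), of "xs @ bs" \<phi>] \<phi> len h(3) concat "is"
      by (simp add: xs_def ys_def)
  qed
qed (use indiscernibleD[OF ind] in auto)

end

section \<open>The type of the points below an element\<close>

lemma realizesD: "realizes C n \<Sigma> b \<Longrightarrow> (\<phi>, bs) \<in> \<Sigma> \<Longrightarrow> sat C (nth (b @ bs)) \<phi>"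
  unfolding realizes_def by blast

lemma realizes_mono: "realizes C n \<Sigma> b \<Longrightarrow> \<Sigma>' \<subseteq> \<Sigma> \<Longrightarrow> realizes C n \<Sigma>' b"
  unfolding realizes_def by blast

context treelike_limit_model begin

lemma realizes_below_iff:
  assumes "c \<in> U"
  shows "realizes A 1 (below_type c) b \<longleftrightarrow> (\<exists>x. b = [x] \<and> x \<in> U \<and> x \<sqsubset> c)"
  using assms by (auto simp: realizes_def below_type_def length_Suc_conv)

text \<open>
  The intervals from \<open>z (2 * r)\<close> to \<open>z (2 * r + 1)\<close>, for \<open>r \<le> m\<close>, are disjoint, so one of these \<open>m + 1\<close>
  intervals contains none of the \<open>m\<close> projections.
\<close>

lemma exists_unseparated_pair:
  assumes c: "c \<in> U" and y: "length y = m" "set y \<subseteq> U"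
    and z: "\<And>r. r < 2 * m + 2 \<Longrightarrow> z r \<in> U \<and> z r \<sqsubset> c"
      "\<And>r r'. r < r' \<Longrightarrow> r' < 2 * m + 2 \<Longrightarrow> z r \<sqsubset> z r'"
  obtains r where "r < m + 1"
    "\<And>e. e \<in> set y \<Longrightarrow> e \<sqinter> c \<sqsubset> z (2 * r) \<or> z (2 * r + 1) \<sqsubset> e \<sqinter> c"
proof -
  define sep where "sep e r \<longleftrightarrow> z (2 * r) \<sqsubseteq> e \<sqinter> c \<and> e \<sqinter> c \<sqsubseteq> z (2 * r + 1)" for e and r :: nat
  have "\<exists>r<m + 1. \<forall>j<m. \<not> sep (y ! j) r"
  proof (rule ccontr)
    assume "\<not> ?thesis"
    then obtain J where J: "\<And>r. r < m + 1 \<Longrightarrow> J r < m \<and> sep (y ! J r) r" by metis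
    have no: False if r: "r < r'" "r' < m + 1" "J r = J r'" for r r'
    proof -
      define e where "e = y ! J r \<sqinter> c"
      have eU: "e \<in> U" using J[of r] r y c by (auto simp: e_def subset_iff)
      have "z (2 * r') \<sqsubseteq> e" "e \<sqsubseteq> z (2 * r + 1)" using J[of r] J[of r'] r by (auto simp: sep_def e_def)
      moreover have "z (2 * r + 1) \<sqsubset> z (2 * r')" using r by (intro z(2)) auto
      ultimately show False
        using z(1)[of "2 * r + 1"] z(1)[of "2 * r'"] r eU
          le_trans[of "z (2 * r')" e "z (2 * r + 1)"] less_not_le by auto
    qed
    have "inj_on J {..<m + 1}"
      using no by (intro inj_onI) (metis lessThan_iff linorder_neqE_nat)
    moreover have "J ` {..<m + 1} \<subseteq> {..<m}" using J by auto
    ultimately have "card {..<m + 1} \<le> card {..<m}" by (intro card_inj_on_le) auto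
    then show False by simp
  qed
  then obtain r where r: "r < m + 1" "\<And>j. j < m \<Longrightarrow> \<not> sep (y ! j) r" by blast
  have "e \<sqinter> c \<sqsubset> z (2 * r) \<or> z (2 * r + 1) \<sqsubset> e \<sqinter> c" if e: "e \<in> set y" for e
  proof -
    have "\<not> sep e r" using r(2) e y by (auto simp: in_set_conv_nth)
    moreover have "e \<in> U" using e y by blast
    ultimately show ?thesis
      using not_le_iff_below[of "z (2 * r)" c "e \<sqinter> c"] not_le_iff_below[of "e \<sqinter> c" c "z (2 * r + 1)"]
        z(1)[of "2 * r"] z(1)[of "2 * r + 1"] r c by (auto simp: sep_def less_def meet_le)
  qed
  then show thesis using that r by blast
qed

text \<open>
  There are finitely many colours, so infinitely many of the points have the same one. Among \<open>2 * m + 2\<close>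
  of these, listed in increasing order, choose parameters \<open>y\<close> for which \<open>\<phi>\<close> holds exactly at the points
  in even position. Two consecutive points that \<open>y\<close> does not separate have the same type over \<open>y\<close>.
\<close>

lemma NIP_below:
  assumes c: "c \<in> U" and fin: "finite (rsyms L)"
  shows "NIP (star_lang L) A 1 (below_type c)"
  unfolding NIP_def
proof
  assume "IP (star_lang L) A 1 (below_type c)"
  then obtain \<phi> m and a :: "nat \<Rightarrow> _ list" where \<phi>: "is_fm (star_lang L) \<phi>" "free_vars \<phi> \<subseteq> {..<m + 1}"
    and a: "\<And>i. realizes A 1 (below_type c) (a i)"
    and cons: "\<And>s. consistent A m ({(\<phi>, a i) | i. i \<in> s} \<union> {(Neg \<phi>, a i) | i. i \<notin> s})"
    unfolding IP_def by blast
  obtain x where x: "a i = [x i]" "x i \<in> U" "x i \<sqsubset> c" for i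
    using a unfolding realizes_below_iff[OF c] by metis
  have pattern: "\<exists>y. length y = m \<and> set y \<subseteq> U \<and> (\<forall>i\<in>F. sat A (nth (y @ [x i])) \<phi> \<longleftrightarrow> i \<in> s)"
    if F: "finite F" for F s
  proof -
    let ?\<Sigma> = "(\<lambda>i. (\<phi>, a i)) ` (F \<inter> s) \<union> (\<lambda>i. (Neg \<phi>, a i)) ` (F - s)"
    obtain y where y: "realizes A m ?\<Sigma> y"
      using cons[of s] F unfolding consistent_def by (elim allE[of _ ?\<Sigma>]) auto
    have "sat A (nth (y @ [x i])) \<phi> \<longleftrightarrow> i \<in> s" if "i \<in> F" for i
    proof (cases "i \<in> s")
      case True
      then have "(\<phi>, [x i]) \<in> ?\<Sigma>" using that x(1) by force
      then show ?thesis using realizesD[OF y] True by blast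
    next
      case False
      then have "(Neg \<phi>, [x i]) \<in> ?\<Sigma>" using that x(1) by force
      then have "sat A (nth (y @ [x i])) (Neg \<phi>)" using realizesD[OF y] by blast
      then show ?thesis using False by simp
    qed
    then show ?thesis using y by (intro exI[of _ y]) (auto simp: realizes_def)
  qed
  have inj: "inj x"
  proof (rule injI, rule ccontr)
    fix i j assume "x i = x j" "i \<noteq> j"
    then show False using pattern[of "{i, j}" "{i}"] by auto
  qed
  define colour where "colour i = {R \<in> rsyms L. rint A (Star R) (x i # replicate (rarity L R) c)}" for i
  have "finite (range colour)"
    by (rule finite_subset[of _ "Pow (rsyms L)"]) (use fin in \<open>auto simp: colour_def\<close>)
  then obtain i\<^sub>0 where "infinite {i \<in> UNIV. colour i = colour i\<^sub>0}"
    using pigeonhole_infinite[of "UNIV :: nat set" colour] by auto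
  then obtain J where J: "finite J" "card J = 2 * m + 2" "J \<subseteq> {i. colour i = colour i\<^sub>0}"
    using infinite_arbitrarily_large by (metis (no_types, lifting) UNIV_I Collect_cong)
  \<comment> \<open>The chain is linearly ordered by \<open>\<sqsubset>\<close>, so the number of smaller points enumerates \<open>J\<close> in increasing order.\<close>
  define rank where "rank i = card {j \<in> J. x j \<sqsubset> x i}" for i
  have rank_less: "rank i < rank j" if "i \<in> J" "x i \<sqsubset> x j" for i j
    unfolding rank_def
  proof (rule psubset_card_mono)
    show "finite {l \<in> J. x l \<sqsubset> x j}" using J by simp
    have "x l \<sqsubset> x j" if "x l \<sqsubset> x i" for l
      using less_le_trans[OF that] \<open>x i \<sqsubset> x j\<close> x by (simp add: less_def)
    then show "{l \<in> J. x l \<sqsubset> x i} \<subset> {l \<in> J. x l \<sqsubset> x j}"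
      using that not_less_self by blast
  qed
  have lin: "x i \<sqsubset> x j \<or> x j \<sqsubset> x i" if "i \<noteq> j" for i j
    using le_linear_below[of "x i" c "x j"] x(2,3) c that inj by (auto simp: less_def inj_eq)
  have "inj_on rank J"
    using lin rank_less by (intro inj_onI) (metis less_irrefl)
  moreover have "rank ` J \<subseteq> {..<2 * m + 2}"
  proof
    fix r assume "r \<in> rank ` J"
    then obtain i where i: "i \<in> J" "r = rank i" by blast
    have "{j \<in> J. x j \<sqsubset> x i} \<subset> J" using i not_less_self by blast
    then show "r \<in> {..<2 * m + 2}" using psubset_card_mono[OF J(1)] i J(2) by (auto simp: rank_def)
  qed
  ultimately have "rank ` J = {..<2 * m + 2}"
    using J by (intro card_subset_eq) (auto simp: card_image)
  then have "\<exists>i\<in>J. rank i = r" if "r < 2 * m + 2" for r using that by (metis imageE lessThan_iff)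
  then obtain p where p: "p r \<in> J" "rank (p r) = r" if "r < 2 * m + 2" for r by metis
  define z where "z r = x (p r)" for r
  have z_less: "z r \<sqsubset> z r'" if "r < r'" "r' < 2 * m + 2" for r r'
  proof -
    have "p r \<in> J" "p r' \<in> J" "rank (p r) < rank (p r')" using p[of r] p[of r'] that by auto
    moreover from this have "p r \<noteq> p r'" by auto
    ultimately show ?thesis using lin rank_less less_asym unfolding z_def by blast
  qed
  obtain y where y: "length y = m" "set y \<subseteq> U"
    and sat: "\<And>i. i \<in> J \<Longrightarrow> sat A (nth (y @ [x i])) \<phi> \<longleftrightarrow> even (rank i)"
    using pattern[OF J(1), of "{i. even (rank i)}"] by auto
  obtain r where r: "r < m + 1"
    and sep: "\<And>e. e \<in> set y \<Longrightarrow> e \<sqinter> c \<sqsubset> z (2 * r) \<or> z (2 * r + 1) \<sqsubset> e \<sqinter> c"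
    using exists_unseparated_pair[OF c y, of z] z_less x by (auto simp: z_def)
  have rr: "2 * r < 2 * m + 2" "2 * r + 1 < 2 * m + 2" using r by auto
  have zz: "z (2 * r) \<sqsubset> z (2 * r + 1)" using z_less rr by simp
  have zU: "z r \<in> U" "z r \<sqsubset> c" "z r \<sqsubseteq> c" for r using x by (auto simp: z_def less_def)
  have col: "rint A (Star R) (z (2 * r) # replicate (rarity L R) c) =
      rint A (Star R) (z (2 * r + 1) # replicate (rarity L R) c)" if "R \<in> rsyms L" for R
  proof -
    have "colour (p (2 * r)) = colour (p (2 * r + 1))" using p rr J(3) by blast
    then show ?thesis using that by (auto simp: colour_def z_def)
  qed
  have sep': "(e \<sqinter> c \<sqsubset> z (2 * r) \<and> e \<sqinter> c \<sqsubset> z (2 * r + 1)) \<or> (z (2 * r) \<sqsubset> e \<sqinter> c \<and> z (2 * r + 1) \<sqsubset> e \<sqinter> c)"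
    if "e \<in> set y" for e
  proof -
    have eU: "e \<sqinter> c \<in> U" using that y c by auto
    show ?thesis
      using sep[OF that] zz less_le_trans[of "e \<sqinter> c" "z (2 * r)" "z (2 * r + 1)"]
        less_le_trans[of "z (2 * r)" "z (2 * r + 1)" "e \<sqinter> c"] eU zU by (auto simp: less_def)
  qed
  obtain S h where h: "partial_embedding S h" "set [z (2 * r)] \<union> set y \<subseteq> S"
    "map h [z (2 * r)] = [z (2 * r + 1)]" "map h y = y"
  proof (rule partial_embedding_move_list[OF c y(2), of "[z (2 * r)]" "[z (2 * r + 1)]"])
    show "x \<in> U \<and> x \<sqsubset> c" if "x \<in> set [z (2 * r)] \<union> set [z (2 * r + 1)]" for x
      using that zU by auto
  qed (use zU col sep' in simp_all)
  have "sat A (nth (y @ [z (2 * r)])) \<phi> = sat A (nth (y @ [z (2 * r + 1)])) \<phi>"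
    using partial_embedding_sat[OF h(1), of "y @ [z (2 * r)]" \<phi>] h \<phi> y by simp
  then show False
    using sat[of "p (2 * r)"] sat[of "p (2 * r + 1)"] p[of "2 * r"] p[of "2 * r + 1"] rr
    by (simp add: z_def)
qed

lemma dp_minimal_below:
  assumes "P \<subseteq> U" "c \<in> P" "below_type c \<subseteq> \<Sigma>"
  shows "dp_minimal TYPE('i::linorder) TYPE('j::linorder) (star_lang L) A P 1 \<Sigma>"
proof -
  have c: "c \<in> U" using assms by blast
  have "\<exists>x. b = [x] \<and> x \<in> U \<and> x \<sqsubset> c" if "realizes A 1 \<Sigma> b" for b
    using realizes_mono[OF that assms(3)] unfolding realizes_below_iff[OF c] .
  then show ?thesis
    unfolding dp_minimal_def using mutually_indiscernible_below[OF _ assms(1,2)] by fastforce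
qed

lemma co_distal_below:
  assumes "P \<subseteq> U" "c \<in> P" "below_type c \<subseteq> \<Sigma>"
  shows "co_distal TYPE('i::linorder) (star_lang L) A P 1 \<Sigma>"
proof -
  have c: "c \<in> U" using assms by blast
  have "\<exists>x. b = [x] \<and> x \<in> U \<and> x \<sqsubset> c" if "realizes A 1 \<Sigma> b" for b
    using realizes_mono[OF that assms(3)] unfolding realizes_below_iff[OF c] .
  then show ?thesis
    unfolding co_distal_def using indiscernible_fill_gap_below[OF _ _ assms(1,2)] by fastforce
qed

lemma distal_below:
  assumes c: "c \<in> U" and "below_type c \<subseteq> \<Sigma>"
  shows "distal TYPE('i::linorder) (star_lang L) A 1 \<Sigma>"
  unfolding distal_def
proof (intro allI impI, elim conjE)
  fix d and I :: "'i set" and k a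
  assume d: "set d \<subseteq> U" and sp: "splits_at I k" and ind: "indiscernible (star_lang L) A {} 1 I a"
    and a: "\<forall>i\<in>I. realizes A 1 \<Sigma> (a i)"
  have "realizes A 1 (below_type c) (a i)" if "i \<in> I" for i
    using a that assms(2) realizes_mono by blast
  then have "\<exists>x. a i = [x] \<and> x \<in> U \<and> x \<sqsubset> c" if "i \<in> I" for i
    using that realizes_below_iff[OF c] by blast
  then obtain x where x: "\<And>i. i \<in> I \<Longrightarrow> a i = [x i]" "\<And>i. i \<in> I \<Longrightarrow> x i \<in> U \<and> x i \<sqsubset> c" by metis
  show "indiscernible (star_lang L) A (set d) 1 (I - {k}) a \<longleftrightarrow> indiscernible (star_lang L) A (set d) 1 I a"
    using indiscernible_fill_gap_chain[OF sp ind x c d] indiscernible_mono by blast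
qed

end

theorem theorem4p27:
  fixes L :: "('f, 'r) lang"
    and T :: "('f, 'r) fm set"
    and N :: "(tree_fun, 'r star_rel, 'n) struct"
    and M \<CC> :: "(tree_fun, 'r star_rel, 'a) struct"
    and \<kappa> :: "'k rel"
    and B :: "'a set"
    and q \<pi> :: "(tree_fun, 'r star_rel, 'a) ptype"
    and c :: 'a
  assumes "relational L" and "finite (rsyms L)"
    and "\<forall>\<sigma>\<in>T. universal_sentence L \<sigma>"
    and "fraisse_class L (finite_models L T)" and "SAP L (finite_models L T)"
    and "fraisse_limit (star_lang L) (finite_models (star_lang L) (star_theory L T)) N"
    and "is_struct (star_lang L) M" and "models M (theory_of (star_lang L) N)"
    and "monster_model (star_lang L) \<kappa> M \<CC>"
    and "branch M B"
    and "complete_type (star_lang L) \<CC> 1 (univ M) q" and "above_type B \<subseteq> q"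
    and "realizes \<CC> 1 q [c]"
    and "\<pi> = q \<union> below_type c"
  shows "dp_minimal TYPE('i::linorder) TYPE('j::linorder) (star_lang L) \<CC> {c} 1 (below_type c)
      \<and> distal TYPE('i) (star_lang L) \<CC> 1 (below_type c)
      \<and> co_distal TYPE('i) (star_lang L) \<CC> {c} 1 (below_type c)
      \<and> NIP (star_lang L) \<CC> 1 (below_type c)
      \<and> dp_minimal TYPE('i) TYPE('j) (star_lang L) \<CC> (univ M \<union> {c}) 1 \<pi>
      \<and> distal TYPE('i) (star_lang L) \<CC> 1 \<pi>
      \<and> co_distal TYPE('i) (star_lang L) \<CC> (univ M \<union> {c}) 1 \<pi>"
proof -
  have elem: "elementary_substruct (star_lang L) M \<CC>"
    using assms(9) by (simp add: monster_model_def)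
  interpret treelike_limit_model L \<CC>
  proof (rule models_limit_theory[OF assms(6,2)])
    show "is_struct (star_lang L) \<CC>" using elem by (simp add: elementary_substruct_def)
    show "models \<CC> (theory_of (star_lang L) N)"
      by (rule elementary_extension_models_theory[OF elem assms(8)])
  qed
  have c: "c \<in> univ \<CC>" using assms(13) by (auto simp: realizes_def)
  have M: "univ M \<union> {c} \<subseteq> univ \<CC>" using elem c by (auto simp: elementary_substruct_def)
  have \<pi>: "below_type c \<subseteq> \<pi>" using assms(14) by blast
  have "{c} \<subseteq> univ \<CC>" using c by blast
  note below = dp_minimal_below[OF this singletonI subset_refl]
    co_distal_below[OF this singletonI subset_refl]
  have "c \<in> univ M \<union> {c}" by blast
  note below_\<pi> = dp_minimal_below[OF M this \<pi>] co_distal_below[OF M this \<pi>]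
  show ?thesis
    by (intro conjI below below_\<pi> distal_below[OF c] NIP_below[OF c assms(2)] \<pi> subset_refl)
qed

end
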